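(* There exists a polynomial function $f$ such that the following holds. Let $n,p \in \mathbb{Z}_{++}$ with $p \le n$, let $H \in \mathbb{Q}^{n\times n}$ be symmetric, $c \in \mathbb{Q}^n$, $d \in \mathbb{Q}$, $A \in \mathbb{Q}^{m\times n}$, $b \in \mathbb{Q}^m$, and let $\phi$ be the complexity of $\{H,c,d,A,b\}$. Let $$\mathcal{F}(H,c,d,A,b) = \{x \in \mathbb{Z}^p \times \mathbb{R}^{n-p} : x^\top H x + c^\top x + d \le 0,\ Ax \le b\}.$$ If $\mathcal{F}(H,c,d,A,b)$ is non-empty, then there exists $x^0 \in \mathcal{F}(H,c,d,A,b)$ whose complexity is at most $f(\phi)$.
   Context: The complexity of a rational vector or matrix is the bit-size of its smallest binary encoding; the complexity of a finite set of objects is the sum of the complexities of its constituents. The polynomial $f$ does not depend on the instance. *)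

theory Defs
  imports
    "Jordan_Normal_Form.Matrix"
    "HOL-Computational_Algebra.Polynomial"
    "HOL-Library.Log_Nat"
begin

text \<open>
  The binary encodings are the usual ones of linear programming theory (Schrijver, \<^emph>\<open>Theory of
  Linear and Integer Programming\<close>): a rational number is written as a sign bit, a binary
  numerator and a binary denominator (least significant bit first). Neither reducedness of the
  fraction nor absence of leading zeros is required of an encoding, hence the minimum in the
  definition of complexity. A vector is the list of its entries and a matrix the list of its rows,
  with one additional bit per entry. The lemmas \<open>rat_complexity_eq\<close>, \<open>vec_complexity_eq\<close> and
  \<open>mat_complexity_eq\<close> recover Schrijver's closed formulas for the size.
\<close>

type_synonym rat_code = "bool \<times> bool list \<times> bool list"

definition bits_val :: "bool list \<Rightarrow> nat" where
  "bits_val bs = horner_sum of_bool 2 bs"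

fun encodes_rat :: "rat_code \<Rightarrow> rat \<Rightarrow> bool" where
  "encodes_rat (s, N, D) r \<longleftrightarrow>
     bits_val D \<noteq> 0 \<and> r = (if s then - 1 else 1) * (of_nat (bits_val N) / of_nat (bits_val D))"

fun rat_code_size :: "rat_code \<Rightarrow> nat" where
  "rat_code_size (s, N, D) = 1 + length N + length D"

definition encodes_vec :: "rat_code list \<Rightarrow> rat vec \<Rightarrow> bool" where
  "encodes_vec es v \<longleftrightarrow> list_all2 encodes_rat es (list_of_vec v)"

definition vec_code_size :: "rat_code list \<Rightarrow> nat" where
  "vec_code_size es = (\<Sum>e\<leftarrow>es. 1 + rat_code_size e)"

definition encodes_mat :: "rat_code list list \<Rightarrow> rat mat \<Rightarrow> bool" where
  "encodes_mat ess M \<longleftrightarrow> list_all2 encodes_vec ess (rows M)"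

definition mat_code_size :: "rat_code list list \<Rightarrow> nat" where
  "mat_code_size ess = (\<Sum>es\<leftarrow>ess. vec_code_size es)"

definition rat_complexity :: "rat \<Rightarrow> nat" where
  "rat_complexity r = (LEAST k. \<exists>e. encodes_rat e r \<and> rat_code_size e = k)"

definition vec_complexity :: "rat vec \<Rightarrow> nat" where
  "vec_complexity v = (LEAST k. \<exists>es. encodes_vec es v \<and> vec_code_size es = k)"

definition mat_complexity :: "rat mat \<Rightarrow> nat" where
  "mat_complexity M = (LEAST k. \<exists>ess. encodes_mat ess M \<and> mat_code_size ess = k)"

text \<open>The data \<open>H, c, d, A, b\<close> are counted with multiplicity, even if two of them coincide.\<close>

definition miqp_complexity ::
  "rat mat \<Rightarrow> rat vec \<Rightarrow> rat \<Rightarrow> rat mat \<Rightarrow> rat vec \<Rightarrow> nat" where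
  "miqp_complexity H c d A b =
     mat_complexity H + vec_complexity c + rat_complexity d + mat_complexity A + vec_complexity b"

definition miqp_feasible ::
  "nat \<Rightarrow> nat \<Rightarrow> rat mat \<Rightarrow> rat vec \<Rightarrow> rat \<Rightarrow> rat mat \<Rightarrow> rat vec \<Rightarrow> real vec set" where
  "miqp_feasible n p H c d A b =
     {x \<in> carrier_vec n.
        (\<forall>i<p. x $ i \<in> \<int>) \<and>
        x \<bullet> (map_mat of_rat H *\<^sub>v x) + map_vec of_rat c \<bullet> x + of_rat d \<le> 0 \<and>
        map_mat of_rat A *\<^sub>v x \<le> map_vec of_rat b}"


lemma floorlog_bits_val_le: "floorlog 2 (bits_val bs) \<le> length bs"
proof -
  have "bits_val bs < 2 ^ length bs"
    unfolding bits_val_def by (rule horner_sum_of_bool_2_less)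
  then show ?thesis
    by (simp add: floorlog_le_iff)
qed

lemma ex_bits_val: "\<exists>bs. bits_val bs = k \<and> length bs = floorlog 2 k"
proof -
  define L where "L = floorlog 2 k"
  have "k < 2 ^ L"
    using floorlog_le_iff[of 2 k L] by (simp add: L_def)
  then have "bits_val (map (bit k) [0..<L]) = k"
    by (simp add: bits_val_def horner_sum_bit_eq_take_bit take_bit_nat_eq_self)
  moreover have "length (map (bit k) [0..<L]) = floorlog 2 k"
    by (simp add: L_def)
  ultimately show ?thesis by blast
qed

lemma Least_sum_list:
  fixes size :: "'e \<Rightarrow> nat"
  assumes ex: "\<And>y. \<exists>e. enc e y"
  shows "(LEAST k. \<exists>es. list_all2 enc es ys \<and> (\<Sum>e\<leftarrow>es. size e) = k) =
         (\<Sum>y\<leftarrow>ys. LEAST k. \<exists>e. enc e y \<and> size e = k)"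
proof (rule Least_equality)
  let ?m = "\<lambda>y. LEAST k. \<exists>e. enc e y \<and> size e = k"
  show "\<exists>es. list_all2 enc es ys \<and> (\<Sum>e\<leftarrow>es. size e) = (\<Sum>y\<leftarrow>ys. ?m y)"
  proof (induction ys)
    case Nil
    show ?case by simp
  next
    case (Cons y ys)
    then obtain es where "list_all2 enc es ys" "(\<Sum>e\<leftarrow>es. size e) = (\<Sum>y\<leftarrow>ys. ?m y)"
      by blast
    moreover have "\<exists>e. enc e y \<and> size e = ?m y"
      by (rule LeastI_ex) (use ex in blast)
    then obtain e where "enc e y" "size e = ?m y" by blast
    ultimately have "list_all2 enc (e # es) (y # ys) \<and>
        (\<Sum>e\<leftarrow>e # es. size e) = (\<Sum>y\<leftarrow>y # ys. ?m y)" by simp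
    then show ?case by blast
  qed
next
  let ?m = "\<lambda>y. LEAST k. \<exists>e. enc e y \<and> size e = k"
  fix k
  assume "\<exists>es. list_all2 enc es ys \<and> (\<Sum>e\<leftarrow>es. size e) = k"
  then obtain es where "list_all2 enc es ys" and k: "(\<Sum>e\<leftarrow>es. size e) = k" by blast
  then have "(\<Sum>y\<leftarrow>ys. ?m y) \<le> (\<Sum>e\<leftarrow>es. size e)"
  proof (induction es ys arbitrary: k rule: list_all2_induct)
    case Nil
    show ?case by simp
  next
    case (Cons e es y ys)
    have "?m y \<le> size e"
      by (rule Least_le) (use Cons.hyps in blast)
    with Cons.IH show ?case by (simp add: add_mono)
  qed
  with k show "(\<Sum>y\<leftarrow>ys. ?m y) \<le> k" by simp
qed

lemma rat_complexity_eq: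
  assumes "quotient_of r = (a, q)"
  shows "rat_complexity r = 1 + floorlog 2 (nat \<bar>a\<bar>) + floorlog 2 (nat q)"
  unfolding rat_complexity_def
proof (rule Least_equality)
  have q: "q > 0" and cop: "coprime a q" and r: "r = of_int a / of_int q"
    using assms by (auto intro: quotient_of_denom_pos quotient_of_coprime quotient_of_div)
  obtain N where N: "bits_val N = nat \<bar>a\<bar>" "length N = floorlog 2 (nat \<bar>a\<bar>)"
    using ex_bits_val by blast
  obtain D where D: "bits_val D = nat q" "length D = floorlog 2 (nat q)"
    using ex_bits_val by blast
  have "encodes_rat (a < 0, N, D) r"
    using q r N D by (simp add: of_nat_nat)
  then show "\<exists>e. encodes_rat e r \<and>
      rat_code_size e = 1 + floorlog 2 (nat \<bar>a\<bar>) + floorlog 2 (nat q)"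
    using N D by (intro exI[of _ "(a < 0, N, D)"]) simp
next
  have q: "q > 0" and cop: "coprime a q" and r: "r = of_int a / of_int q"
    using assms by (auto intro: quotient_of_denom_pos quotient_of_coprime quotient_of_div)
  fix k
  assume "\<exists>e. encodes_rat e r \<and> rat_code_size e = k"
  then obtain s N D where e: "encodes_rat (s, N, D) r" and k: "k = 1 + length N + length D"
    by (metis prod_cases3 rat_code_size.simps)
  define x where "x = nat \<bar>a\<bar>"
  define y where "y = nat q"
  have D0: "bits_val D > 0" using e by simp
  have y0: "y > 0" using q by (simp add: y_def)
  have "\<bar>r\<bar> = of_nat (bits_val N) / of_nat (bits_val D)"
    using e by (auto simp: abs_mult)
  moreover have "\<bar>r\<bar> = of_nat x / of_nat y"
    using r q by (simp add: x_def y_def of_nat_nat)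
  ultimately have "(of_nat (x * bits_val D) :: rat) = of_nat (bits_val N * y)"
    using D0 y0 by (simp add: field_simps)
  then have eq: "x * bits_val D = bits_val N * y"
    by (simp only: of_nat_eq_iff)
  have cop': "coprime x y"
    using cop q by (simp add: x_def y_def coprime_int_iff[symmetric])
  have "y dvd x * bits_val D" by (simp add: eq)
  then have "y dvd bits_val D"
    using cop' by (simp add: coprime_commute coprime_dvd_mult_right_iff)
  then have yD: "y \<le> bits_val D" using D0 by (rule dvd_imp_le)
  have xN: "x \<le> bits_val N"
  proof -
    have "x * y \<le> bits_val N * y" using yD eq by (metis mult_le_mono2)
    then show ?thesis using y0 by simp
  qed
  have "floorlog 2 x \<le> length N"
    using floorlog_mono[OF xN] floorlog_bits_val_le order_trans by blast
  moreover have "floorlog 2 y \<le> length D"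
    using floorlog_mono[OF yD] floorlog_bits_val_le order_trans by blast
  ultimately show "1 + floorlog 2 (nat \<bar>a\<bar>) + floorlog 2 (nat q) \<le> k"
    by (simp add: k x_def y_def)
qed

lemma ex_encodes_rat: "\<exists>e. encodes_rat e r"
proof -
  obtain a q where aq: "quotient_of r = (a, q)" by fastforce
  have q: "q > 0" and r: "r = of_int a / of_int q"
    using aq by (auto intro: quotient_of_denom_pos quotient_of_div)
  obtain N D where "bits_val N = nat \<bar>a\<bar>" "bits_val D = nat q"
    using ex_bits_val by meson
  then have "encodes_rat (a < 0, N, D) r"
    using q r by (simp add: of_nat_nat)
  then show ?thesis by blast
qed

lemma Least_Suc_rat:
  "(LEAST k. \<exists>e. encodes_rat e r \<and> 1 + rat_code_size e = k) = 1 + rat_complexity r"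
proof (rule Least_equality)
  have "\<exists>e. encodes_rat e r \<and> rat_code_size e = rat_complexity r"
    unfolding rat_complexity_def by (rule LeastI_ex) (use ex_encodes_rat in blast)
  then show "\<exists>e. encodes_rat e r \<and> 1 + rat_code_size e = 1 + rat_complexity r" by auto
next
  fix k
  assume "\<exists>e. encodes_rat e r \<and> 1 + rat_code_size e = k"
  then obtain e where "encodes_rat e r" "k = 1 + rat_code_size e" by blast
  moreover from this have "rat_complexity r \<le> rat_code_size e"
    unfolding rat_complexity_def by (intro Least_le) blast
  ultimately show "1 + rat_complexity r \<le> k" by simp
qed

lemma vec_complexity_list: "vec_complexity v = (\<Sum>r\<leftarrow>list_of_vec v. 1 + rat_complexity r)"
  unfolding vec_complexity_def encodes_vec_def vec_code_size_def
  by (subst Least_sum_list[OF ex_encodes_rat]) (simp add: Least_Suc_rat[simplified])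

lemma vec_complexity_eq:
  "vec_complexity v = dim_vec v + (\<Sum>i<dim_vec v. rat_complexity (v $ i))"
  by (simp add: vec_complexity_list list_of_vec_map comp_def
      interv_sum_list_conv_sum_set_nat atLeast0LessThan sum_Suc)

lemma ex_encodes_vec: "\<exists>es. encodes_vec es v"
proof -
  have "\<exists>es. list_all2 encodes_rat es rs" for rs
    by (induction rs) (use ex_encodes_rat in \<open>auto simp: list_all2_Cons2\<close>)
  then show ?thesis by (simp add: encodes_vec_def)
qed

lemma mat_complexity_list: "mat_complexity M = (\<Sum>v\<leftarrow>rows M. vec_complexity v)"
  unfolding mat_complexity_def encodes_mat_def mat_code_size_def vec_complexity_def
  by (rule Least_sum_list[OF ex_encodes_vec])

lemma mat_complexity_eq:
  "mat_complexity M = dim_row M * dim_col M +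
     (\<Sum>i<dim_row M. \<Sum>j<dim_col M. rat_complexity (M $$ (i, j)))"
  by (simp add: mat_complexity_list rows_def vec_complexity_eq comp_def
      interv_sum_list_conv_sum_set_nat atLeast0LessThan sum.distrib)

end

theory Submission
  imports Defs "HOL-Analysis.Function_Topology"
begin

text \<open>
  All bounds come from one fact: on a polytope with integer data of bit size \<open>\<beta>\<close>, a quadratic
  function attains its minimum at a rational point of size polynomial in \<open>\<beta>\<close> and the number of
  variables and constraints.

  A feasible \<open>x\<close> is written as \<open>z + \<Sum>\<^sub>i k\<^sub>i r\<^sub>i\<close> with natural numbers \<open>k\<^sub>i\<close>, small integral recession
  directions \<open>r\<^sub>i\<close>, and a mixed-integer point \<open>z\<close> of the polyhedron of small norm. Let
  \<open>M\<^sub>i\<^sub>j = r\<^sub>i\<^sup>T H r\<^sub>j\<close> and minimise the form \<open>\<mu>\<^sup>T M \<mu>\<close> over the faces of the standard simplex; the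
  minimisers are small. If some minimum is negative, or some minimum is zero and the objective
  decreases along the corresponding direction from some small \<open>z\<close>, then following this direction
  from a small point reaches a small feasible point. Otherwise take \<open>\<Sum>\<^sub>i k\<^sub>i\<close> minimal and let \<open>J\<close> be
  the set of indices with large \<open>k\<^sub>i\<close>. A zero of the form supported in \<open>J\<close> could be subtracted
  from \<open>k\<close> without increasing the objective, so the form is strictly copositive on \<open>J\<close>, with a
  quantitative lower bound, and this bounds \<open>k\<close>. Hence \<open>x\<close> is bounded; fixing its integer
  coordinates leaves a quadratic program on a polytope.
\<close>

section \<open>Small solutions of integer linear systems\<close>

text \<open>The boundary of the region cut out by the quadratic inequality may contain no rational
  point. Minimising the quadratic function, rather than solving the inequality, leads to linear
  first-order conditions with integer data, so a minimiser can be chosen rational, and it satisfies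
  the inequality as soon as the given point does. Two obstacles prevent a direct use of this: the
  integer coordinates must be fixed first, at values that may be huge, and \<open>H\<close> may be
  indefinite, so neither convexity nor bounded level sets are available. Splitting off natural
  multiples of integral rays isolates the unbounded part without disturbing integrality. Integrality
  also supplies every quantitative gap: a negative integer is at most \<open>-1\<close> and a
  positive one at least \<open>1\<close>, so descent rates and the copositivity constant are bounded
  below in terms of known denominators. Solutions of linear systems are bounded by Siegel's lemma in
  place of Cramer's rule; determinants never appear.\<close>

lemma siegel:
  fixes a :: "'i \<Rightarrow> 'v \<Rightarrow> int" and C :: nat
  assumes "finite V" "finite I" and card: "card I < card V"
    and C: "C \<ge> 1" and a: "\<And>i v. i \<in> I \<Longrightarrow> v \<in> V \<Longrightarrow> \<bar>a i v\<bar> \<le> int C"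
  obtains y :: "'v \<Rightarrow> int" where "\<exists>v\<in>V. y v \<noteq> 0" "\<forall>i\<in>I. (\<Sum>v\<in>V. a i v * y v) = 0"
    "\<forall>v\<in>V. \<bar>y v\<bar> \<le> int ((card V * C) ^ card I)"
proof -
  define P where "P = card V * C"
  \<comment> \<open>Pigeonhole on the cube with side \<open>X\<close>. The image box has at most
    \<open>P * (X + 1)\<close> values per row, and this choice of \<open>X\<close> turns their
    product into \<open>X * (X + 1) ^ card I\<close>, just below the \<open>(X + 1) ^ card V\<close>
    points of the cube. The difference of two colliding points is the solution.\<close>
  define X where "X = P ^ card I"
  have P1: "P \<ge> 1" using card C by (simp add: P_def Suc_leI)
  define D where "D = V \<rightarrow>\<^sub>E {0..int X}"
  \<comment> \<open>Extreme values of row \<open>i\<close> on the cube: negative coefficients meet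
    \<open>X\<close> and positive ones \<open>0\<close> for the minimum, conversely for the
    maximum.\<close>
  define lo where "lo i = (\<Sum>v\<in>V. min (a i v) 0) * int X" for i
  define hi where "hi i = (\<Sum>v\<in>V. max (a i v) 0) * int X" for i
  define R where "R = (\<Pi>\<^sub>E i\<in>I. {lo i..hi i})"
  define \<phi> where "\<phi> y = (\<lambda>i\<in>I. \<Sum>v\<in>V. a i v * y v)" for y
  have cardD: "card D = (X + 1) ^ card V"
    using assms by (simp add: D_def card_PiE nat_add_distrib)
  have len: "nat (hi i - lo i + 1) \<le> P * (X + 1)" if i: "i \<in> I" for i
  proof -
    have "hi i - lo i = (\<Sum>v\<in>V. \<bar>a i v\<bar>) * int X"
      unfolding hi_def lo_def left_diff_distrib[symmetric] sum_subtractf[symmetric]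
      by (intro arg_cong2[where f="(*)"] sum.cong) auto
    also have "\<dots> \<le> (int (card V) * int C) * int X"
      using a[OF i] by (intro mult_right_mono sum_bounded_above) auto
    finally have "hi i - lo i \<le> int (P * X)" by (simp add: P_def)
    then have "hi i - lo i + 1 \<le> int (P * X + P)" using P1 by simp
    then show ?thesis by (simp add: nat_le_iff algebra_simps)
  qed
  have "card R = (\<Prod>i\<in>I. nat (hi i - lo i + 1))"
    using assms by (simp add: R_def card_PiE)
  also have "\<dots> \<le> (\<Prod>i\<in>I. P * (X + 1))"
    using len by (intro prod_mono) auto
  also have "\<dots> = X * (X + 1) ^ card I"
    by (simp add: X_def power_mult_distrib del: mult_Suc_right mult_Suc add_Suc_right)
  also have "\<dots> < (X + 1) ^ (card I + 1)" by simp
  also have "\<dots> \<le> (X + 1) ^ card V" using card by (intro power_increasing) auto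
  finally have lt: "card R < card D" using cardD by simp
  have finR: "finite R" using assms by (simp add: R_def finite_PiE)
  have "\<phi> ` D \<subseteq> R"
  proof (clarsimp simp: R_def \<phi>_def)
    fix y i assume y: "y \<in> D" and i: "i \<in> I"
    have y': "0 \<le> y v \<and> y v \<le> int X" if "v \<in> V" for v
      using y that by (auto simp: D_def PiE_def Pi_def)
    have m1: "b * z \<le> max b 0 * int X" if "0 \<le> z" "z \<le> int X" for b z :: int
      using that by (cases "b \<ge> 0") (auto simp: mult_left_mono max_def mult_nonpos_nonneg)
    have m2: "min b 0 * int X \<le> b * z" if "0 \<le> z" "z \<le> int X" for b z :: int
      using that by (cases "b \<ge> 0") (auto simp: min_def mult_left_mono_neg)
    show "lo i \<le> (\<Sum>v\<in>V. a i v * y v) \<and> (\<Sum>v\<in>V. a i v * y v) \<le> hi i"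
      unfolding lo_def hi_def sum_distrib_right using y' by (auto intro!: sum_mono m1 m2)
  qed
  then have "card (\<phi> ` D) < card D"
    using lt card_mono[OF finR] by (metis le_less_trans)
  then have "\<not> inj_on \<phi> D" by (metis card_image less_irrefl)
  then obtain y1 y2 where y: "y1 \<in> D" "y2 \<in> D" "\<phi> y1 = \<phi> y2" "y1 \<noteq> y2"
    by (auto simp: inj_on_def)
  obtain v where "y1 v \<noteq> y2 v" using y(4) by blast
  then have "v \<in> V" using y by (auto simp: D_def PiE_def extensional_def)
  show thesis
  proof
    show "\<exists>v\<in>V. y1 v - y2 v \<noteq> 0" using \<open>v \<in> V\<close> \<open>y1 v \<noteq> y2 v\<close> by auto
    show "\<forall>i\<in>I. (\<Sum>v\<in>V. a i v * (y1 v - y2 v)) = 0"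
    proof
      fix i assume "i \<in> I"
      then show "(\<Sum>v\<in>V. a i v * (y1 v - y2 v)) = 0"
        using fun_cong[OF y(3), of i]
        by (simp add: \<phi>_def right_diff_distrib sum_subtractf)
    qed
    show "\<forall>v\<in>V. \<bar>y1 v - y2 v\<bar> \<le> int ((card V * C) ^ card I)"
    proof
      fix v assume "v \<in> V"
      then have "y1 v \<in> {0..int X}" "y2 v \<in> {0..int X}"
        using y(1,2) by (auto simp: D_def PiE_def Pi_def)
      then show "\<bar>y1 v - y2 v\<bar> \<le> int ((card V * C) ^ card I)"
        unfolding X_def P_def by auto
    qed
  qed
qed

text \<open>The normal equations \<open>a\<^sup>T a x = a\<^sup>T h\<close> form a square system, so after homogenisation
  there is one more unknown than there are equations and Siegel's lemma applies.\<close>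

lemma unique_solution_small:
  fixes a :: "'i \<Rightarrow> 'v \<Rightarrow> int" and h :: "'i \<Rightarrow> int" and B :: nat and x :: "'v \<Rightarrow> real"
  assumes fin: "finite V" "finite I" and B: "B \<ge> 1"
    and a: "\<And>i v. i \<in> I \<Longrightarrow> v \<in> V \<Longrightarrow> \<bar>a i v\<bar> \<le> int B"
    and h: "\<And>i. i \<in> I \<Longrightarrow> \<bar>h i\<bar> \<le> int B"
    and x: "\<And>i. i \<in> I \<Longrightarrow> (\<Sum>v\<in>V. a i v * x v) = h i"
    and indep: "\<And>y :: 'v \<Rightarrow> real. (\<And>i. i \<in> I \<Longrightarrow> (\<Sum>v\<in>V. a i v * y v) = 0) \<Longrightarrow> (\<And>v. v \<in> V \<Longrightarrow> y v = 0)"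
  obtains t :: int and N :: "'v \<Rightarrow> int" where
    "t \<ge> 1" "t \<le> int (((card V + 1) * ((card I + 1) * B\<^sup>2)) ^ card V)"
    "\<And>v. v \<in> V \<Longrightarrow> \<bar>N v\<bar> \<le> int (((card V + 1) * ((card I + 1) * B\<^sup>2)) ^ card V)"
    "\<And>v. v \<in> V \<Longrightarrow> x v = N v / t"
proof -
  define W where "W = insert None (Some ` V)"
  \<comment> \<open>Rows are the normal equations; the column \<open>None\<close> carries the
    right-hand side and belongs to the homogenising unknown.\<close>
  define G where "G u w = (case w of None \<Rightarrow> - (\<Sum>i\<in>I. a i u * h i)
     | Some v \<Rightarrow> (\<Sum>i\<in>I. a i u * a i v))" for u w
  \<comment> \<open>Bound for the entries of the normal equations; the summand \<open>+ 1\<close>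
    keeps it positive when \<open>I\<close> is empty.\<close>
  define C where "C = (card I + 1) * B\<^sup>2"
  have cW: "card W = card V + 1"
    using fin by (simp add: W_def card_insert_if card_image)
  have prod: "\<bar>(\<Sum>i\<in>I. f i * g i)\<bar> \<le> int C"
    if "\<And>i. i \<in> I \<Longrightarrow> \<bar>f i\<bar> \<le> int B" "\<And>i. i \<in> I \<Longrightarrow> \<bar>g i\<bar> \<le> int B" for f g :: "'i \<Rightarrow> int"
  proof -
    have "\<bar>(\<Sum>i\<in>I. f i * g i)\<bar> \<le> (\<Sum>i\<in>I. \<bar>f i * g i\<bar>)" by (rule sum_abs)
    also have "\<dots> \<le> (\<Sum>i\<in>I. int B * int B)"
      using that by (intro sum_mono) (simp add: abs_mult mult_mono)
    also have "\<dots> \<le> int C" by (simp add: C_def power2_eq_square algebra_simps)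
    finally show ?thesis .
  qed
  have G: "\<bar>G u w\<bar> \<le> int C" if "u \<in> V" "w \<in> W" for u w
    using that a h by (cases w) (auto simp: G_def W_def intro!: prod)
  have "C \<ge> 1" using B by (simp add: C_def Suc_le_eq)
  then obtain y where y: "\<exists>w\<in>W. y w \<noteq> 0" "\<forall>u\<in>V. (\<Sum>w\<in>W. G u w * y w) = 0"
     "\<forall>w\<in>W. \<bar>y w\<bar> \<le> int ((card W * C) ^ card V)"
    using siegel[of W V C G] fin cW G by (auto simp: W_def)
  define t where "t = y None"
  define z where "z v = y (Some v) - t * x v" for v
  have inner: "(\<Sum>v\<in>V. a i v * z v) = (\<Sum>v\<in>V. a i v * y (Some v)) - t * h i" if "i \<in> I" for i
    by (simp add: z_def right_diff_distrib sum_subtractf x[OF that, symmetric] sum_distrib_left mult_ac)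
  have normal: "(\<Sum>i\<in>I. a i u * (\<Sum>v\<in>V. a i v * z v)) = 0" if u: "u \<in> V" for u
  proof -
    have "0 = (\<Sum>w\<in>W. G u w * y w)" using y u by simp
    also have "\<dots> = G u None * t + (\<Sum>v\<in>V. G u (Some v) * y (Some v))"
      using fin by (simp add: W_def t_def sum.reindex)
    also have "\<dots> = (\<Sum>i\<in>I. a i u * ((\<Sum>v\<in>V. a i v * y (Some v)) - t * h i))"
      by (simp add: G_def right_diff_distrib sum_subtractf sum_distrib_left sum_distrib_right
           sum.swap[of _ V I] mult_ac)
    finally have "0 = real_of_int (\<Sum>i\<in>I. a i u * ((\<Sum>v\<in>V. a i v * y (Some v)) - t * h i))"
      by simp
    also have "\<dots> = (\<Sum>i\<in>I. a i u * (\<Sum>v\<in>V. a i v * z v))"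
      using inner by simp
    finally show ?thesis by simp
  qed
  \<comment> \<open>Pairing the normal equations with \<open>z\<close> gives the squared norm of the
    residual, so over the reals they lose nothing against the original system.\<close>
  have "(\<Sum>i\<in>I. (\<Sum>v\<in>V. a i v * z v)\<^sup>2) = (\<Sum>u\<in>V. z u * (\<Sum>i\<in>I. a i u * (\<Sum>v\<in>V. a i v * z v)))"
    by (simp add: power2_eq_square sum_distrib_left sum_distrib_right sum.swap[of _ V I] mult_ac)
  also have "\<dots> = 0" using normal by simp
  finally have "\<forall>i\<in>I. (\<Sum>v\<in>V. a i v * z v) = 0"
    using fin by (simp add: sum_nonneg_eq_0_iff)
  then have z0: "z v = 0" if "v \<in> V" for v using indep that by blast
  \<comment> \<open>For \<open>t = 0\<close> the vector \<open>z\<close> is \<open>y\<close> itself,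
    and independence would make the nontrivial solution vanish.\<close>
  have t0: "t \<noteq> 0"
  proof
    assume "t = 0"
    then have "y w = 0" if "w \<in> W" for w
      using that z0 by (auto simp: W_def z_def t_def)
    then show False using y by blast
  qed
  have NW: "None \<in> W" and SW: "v \<in> V \<Longrightarrow> Some v \<in> W" for v by (auto simp: W_def)
  have bnd: "\<bar>y w\<bar> \<le> int (((card V + 1) * ((card I + 1) * B\<^sup>2)) ^ card V)" if "w \<in> W" for w
    using y(3) that unfolding cW C_def by blast
  show thesis
  proof (rule that[of "\<bar>t\<bar>" "\<lambda>v. sgn t * y (Some v)"])
    show "1 \<le> \<bar>t\<bar>" using t0 by auto
    show "\<bar>t\<bar> \<le> int (((card V + 1) * ((card I + 1) * B\<^sup>2)) ^ card V)"
      using bnd[OF NW] by (simp only: t_def)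
    show "\<bar>sgn t * y (Some v)\<bar> \<le> int (((card V + 1) * ((card I + 1) * B\<^sup>2)) ^ card V)" if "v \<in> V" for v
      using bnd[OF SW[OF that]] t0 by (simp only: abs_mult abs_sgn_eq) simp
    show "x v = real_of_int (sgn t * y (Some v)) / real_of_int \<bar>t\<bar>" if "v \<in> V" for v
      using z0[OF that] t0 by (auto simp: z_def sgn_if field_simps)
  qed
qed

text \<open>A real solution of minimal support uses independent columns: otherwise a multiple of a
  kernel vector on the support could be subtracted to kill one more coordinate. Restricted to its
  support the solution is unique, hence small and rational, and it is extended by zero.\<close>

lemma linear_system_small_solution:
  fixes a :: "'i \<Rightarrow> 'v \<Rightarrow> int" and h :: "'i \<Rightarrow> int" and B :: nat and x :: "'v \<Rightarrow> real"
  assumes fin: "finite V" "finite I" and B: "B \<ge> 1"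
    and a: "\<And>i v. i \<in> I \<Longrightarrow> v \<in> V \<Longrightarrow> \<bar>a i v\<bar> \<le> int B"
    and h: "\<And>i. i \<in> I \<Longrightarrow> \<bar>h i\<bar> \<le> int B"
    and x: "\<And>i. i \<in> I \<Longrightarrow> (\<Sum>v\<in>V. a i v * x v) = h i"
  obtains t :: int and N :: "'v \<Rightarrow> int" where
    "t \<ge> 1" "t \<le> int (((card V + 1) * ((card I + 1) * B\<^sup>2)) ^ card V)"
    "\<And>v. \<bar>N v\<bar> \<le> int (((card V + 1) * ((card I + 1) * B\<^sup>2)) ^ card V)"
    "\<And>i. i \<in> I \<Longrightarrow> (\<Sum>v\<in>V. a i v * (N v / t)) = h i"
proof -
  define sol where "sol y \<longleftrightarrow> (\<forall>i\<in>I. (\<Sum>v\<in>V. a i v * y v) = real_of_int (h i))" for y :: "'v \<Rightarrow> real"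
  define supp where "supp y = {v \<in> V. y v \<noteq> (0::real)}" for y
  obtain y where y: "sol y" and min: "\<And>y'. sol y' \<Longrightarrow> card (supp y) \<le> card (supp y')"
    using ex_has_least_nat[of sol x "\<lambda>y. card (supp y)"] x unfolding sol_def by blast
  define J where "J = supp y"
  have J: "finite J" "J \<subseteq> V" using fin by (auto simp: J_def supp_def)
  have sumJ: "(\<Sum>v\<in>V. a i v * z v) = (\<Sum>v\<in>J. a i v * z v)" if "\<And>v. v \<in> V - J \<Longrightarrow> z v = 0"
    for i and z :: "'v \<Rightarrow> real"
    using that fin J by (intro sum.mono_neutral_right) auto
  have y0: "v \<in> V - J \<Longrightarrow> y v = 0" for v by (auto simp: J_def supp_def)
  have indep: "z v = 0"
    if z: "\<And>i. i \<in> I \<Longrightarrow> (\<Sum>v\<in>J. a i v * z v) = 0" and v: "v \<in> J" for z :: "'v \<Rightarrow> real" and v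
  proof (rule ccontr)
    assume nz: "z v \<noteq> 0"
    define z' where "z' u = (if u \<in> J then z u else 0)" for u
    define y' where "y' u = y u - (y v / z v) * z' u" for u
    have "(\<Sum>u\<in>V. a i u * z' u) = 0" if "i \<in> I" for i
      using z[OF that] sumJ[of z' i] by (simp add: z'_def)
    then have "sol y'"
      using y by (simp add: sol_def y'_def right_diff_distrib sum_subtractf sum_distrib_left[symmetric]
         mult.left_commute[of _ "y v / z v"] del: times_divide_eq_left)
    moreover have "supp y' \<subset> J"
    proof
      show "supp y' \<subseteq> J" using y0 by (auto simp: supp_def y'_def z'_def split: if_splits)
      have "y' v = 0" using v nz by (simp add: y'_def z'_def)
      then show "supp y' \<noteq> J" using v by (auto simp: supp_def)
    qed
    ultimately show False using min[of y'] J psubset_card_mono[of J "supp y'"] by (simp add: J_def)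
  qed
  have solJ: "(\<Sum>v\<in>J. a i v * y v) = h i" if "i \<in> I" for i
    using y sumJ[OF y0] that by (simp add: sol_def)
  obtain t N where tN: "t \<ge> 1" "t \<le> int (((card J + 1) * ((card I + 1) * B\<^sup>2)) ^ card J)"
    "\<And>v. v \<in> J \<Longrightarrow> \<bar>N v\<bar> \<le> int (((card J + 1) * ((card I + 1) * B\<^sup>2)) ^ card J)"
    "\<And>v. v \<in> J \<Longrightarrow> y v = N v / t"
  proof (rule unique_solution_small[of J I B a h y])
    show "\<bar>a i v\<bar> \<le> int B" if "i \<in> I" "v \<in> J" for i v using a that J by blast
    show "v \<in> J \<Longrightarrow> z v = 0" if "\<And>i. i \<in> I \<Longrightarrow> (\<Sum>v\<in>J. a i v * z v) = 0"
      for z :: "'v \<Rightarrow> real" and v using indep that by blast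
  qed (use J fin B h solJ in blast)+
  have cJ: "card J \<le> card V" using J fin card_mono by blast
  have "((card J + 1) * ((card I + 1) * B\<^sup>2)) ^ card J \<le> ((card V + 1) * ((card I + 1) * B\<^sup>2)) ^ card J"
    using cJ by (intro power_mono mult_right_mono) auto
  also have "\<dots> \<le> ((card V + 1) * ((card I + 1) * B\<^sup>2)) ^ card V"
    using cJ B by (intro power_increasing) (auto simp: Suc_le_eq)
  finally have K: "int (((card J + 1) * ((card I + 1) * B\<^sup>2)) ^ card J)
      \<le> int (((card V + 1) * ((card I + 1) * B\<^sup>2)) ^ card V)" by (simp only: of_nat_le_iff)
  define N' where "N' v = (if v \<in> J then N v else 0)" for v
  show thesis
  proof (rule that[of t N'])
    show "1 \<le> t" "t \<le> int (((card V + 1) * ((card I + 1) * B\<^sup>2)) ^ card V)"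
      using tN(1) order_trans[OF tN(2) K] by auto
    show "\<bar>N' v\<bar> \<le> int (((card V + 1) * ((card I + 1) * B\<^sup>2)) ^ card V)" for v
      using order_trans[OF tN(3) K] unfolding N'_def by (auto simp del: of_nat_mult of_nat_power)
    have "y v = N' v / t" if "v \<in> V" for v
      using that tN(4) y0 by (auto simp: N'_def)
    then show "(\<Sum>v\<in>V. a i v * (N' v / t)) = h i" if "i \<in> I" for i
      using y that by (simp add: sol_def)
  qed
qed

section \<open>Quadratic programs on polytopes\<close>

text \<open>Vectors are functions on an index set instead of elements of a space of fixed dimension,
  because the same forms are needed on \<open>V\<close>, on its homogenisation by an
  \<open>option\<close> type and on sets of ray indices.\<close>

definition lin :: "'v set \<Rightarrow> ('v \<Rightarrow> int) \<Rightarrow> ('v \<Rightarrow> real) \<Rightarrow> real" where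
  "lin V a x = (\<Sum>v\<in>V. a v * x v)"

definition bil :: "'v set \<Rightarrow> ('v \<Rightarrow> 'v \<Rightarrow> int) \<Rightarrow> ('v \<Rightarrow> real) \<Rightarrow> ('v \<Rightarrow> real) \<Rightarrow> real" where
  "bil V Q x y = (\<Sum>u\<in>V. \<Sum>v\<in>V. Q u v * x u * y v)"

definition quad :: "'v set \<Rightarrow> ('v \<Rightarrow> 'v \<Rightarrow> int) \<Rightarrow> ('v \<Rightarrow> int) \<Rightarrow> ('v \<Rightarrow> real) \<Rightarrow> real" where
  "quad V Q g x = bil V Q x x + lin V g x"

text \<open>The directional derivative of \<open>quad V Q g\<close>; there are two bilinear terms because \<open>Q\<close> need
  not be symmetric.\<close>

definition dquad ::
  "'v set \<Rightarrow> ('v \<Rightarrow> 'v \<Rightarrow> int) \<Rightarrow> ('v \<Rightarrow> int) \<Rightarrow> ('v \<Rightarrow> real) \<Rightarrow> ('v \<Rightarrow> real) \<Rightarrow> real" where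
  "dquad V Q g x y = bil V Q x y + bil V Q y x + lin V g y"

text \<open>Equations enter as two opposite inequalities. Values outside \<open>V\<close> are
  unconstrained, so points matter only up to agreement on \<open>V\<close>.\<close>

definition feas :: "'v set \<Rightarrow> (('v \<Rightarrow> int) \<times> int) set \<Rightarrow> ('v \<Rightarrow> real) set" where
  "feas V Cs = {x. \<forall>c\<in>Cs. lin V (fst c) x \<le> real_of_int (snd c)}"

section \<open>Algebra of linear, bilinear and quadratic forms\<close>

lemma lin_cong: "(\<And>v. v \<in> V \<Longrightarrow> x v = y v) \<Longrightarrow> lin V a x = lin V a y"
  by (simp add: lin_def)

lemma bil_cong:
  "(\<And>v. v \<in> V \<Longrightarrow> x v = x' v) \<Longrightarrow> (\<And>v. v \<in> V \<Longrightarrow> y v = y' v) \<Longrightarrow> bil V Q x y = bil V Q x' y'"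
  by (simp add: bil_def)

lemma quad_cong: "(\<And>v. v \<in> V \<Longrightarrow> x v = y v) \<Longrightarrow> quad V Q g x = quad V Q g y"
  unfolding quad_def by (metis lin_cong bil_cong)

lemma feas_cong: "(\<And>v. v \<in> V \<Longrightarrow> x v = y v) \<Longrightarrow> x \<in> feas V Cs \<longleftrightarrow> y \<in> feas V Cs"
  unfolding feas_def using lin_cong[of V x y] by simp

lemma lin_add: "lin V a (\<lambda>v. x v + y v) = lin V a x + lin V a y"
  by (simp add: lin_def distrib_left sum.distrib)

lemma lin_diff: "lin V a (\<lambda>v. x v - y v) = lin V a x - lin V a y"
  by (simp add: lin_def right_diff_distrib sum_subtractf)

lemma lin_scale: "lin V a (\<lambda>v. s * x v) = s * lin V a x"
  by (simp add: lin_def sum_distrib_left mult_ac)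

lemma lin_minus: "lin V (\<lambda>v. - a v) x = - lin V a x"
  by (simp add: lin_def sum_negf)

lemma lin_sum: "lin V a (\<lambda>v. \<Sum>i\<in>I. f i v) = (\<Sum>i\<in>I. lin V a (f i))"
  by (simp add: lin_def sum_distrib_left sum.swap[of _ V I])

lemma bil_add_left: "bil V Q (\<lambda>v. x v + y v) z = bil V Q x z + bil V Q y z"
  by (simp add: bil_def distrib_left distrib_right sum.distrib)

lemma bil_add_right: "bil V Q z (\<lambda>v. x v + y v) = bil V Q z x + bil V Q z y"
  by (simp add: bil_def distrib_left sum.distrib)

lemma bil_scale_left: "bil V Q (\<lambda>v. s * x v) z = s * bil V Q x z"
  by (simp add: bil_def sum_distrib_left mult_ac)

lemma bil_scale_right: "bil V Q z (\<lambda>v. s * x v) = s * bil V Q z x"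
  by (simp add: bil_def sum_distrib_left mult_ac)

lemma bil_sum_left: "bil V Q (\<lambda>v. \<Sum>i\<in>I. f i v) z = (\<Sum>i\<in>I. bil V Q (f i) z)"
  by (induction I rule: infinite_finite_induct) (simp_all add: bil_add_left, simp_all add: bil_def)

lemma bil_sum_right: "bil V Q z (\<lambda>v. \<Sum>i\<in>I. f i v) = (\<Sum>i\<in>I. bil V Q z (f i))"
  by (induction I rule: infinite_finite_induct) (simp_all add: bil_add_right, simp_all add: bil_def)

lemma dquad_add: "dquad V Q g x (\<lambda>v. y v + z v) = dquad V Q g x y + dquad V Q g x z"
  by (simp add: dquad_def lin_add bil_add_left bil_add_right)

lemma dquad_scale: "dquad V Q g x (\<lambda>v. s * y v) = s * dquad V Q g x y"
  by (simp add: dquad_def lin_scale bil_scale_left bil_scale_right algebra_simps)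

lemma quad_line:
  "quad V Q g (\<lambda>v. x v + s * y v) = quad V Q g x + s * dquad V Q g x y + s\<^sup>2 * bil V Q y y"
  by (simp add: quad_def dquad_def lin_add lin_scale bil_add_left bil_add_right
      bil_scale_left bil_scale_right power2_eq_square algebra_simps)

text \<open>Source of the Lagrange multipliers. By induction on \<open>E\<close>: either
  \<open>f e\<close> already vanishes on the common kernel of the others and gets coefficient
  \<open>0\<close>, or some \<open>u\<close> in that kernel has \<open>f e u\<close> nonzero, and
  subtracting \<open>g u / f e u\<close> times \<open>f e\<close> from \<open>g\<close> reduces to
  the others.\<close>

lemma functional_in_span:
  fixes f :: "'i \<Rightarrow> ('v \<Rightarrow> real) \<Rightarrow> real"
  assumes "finite E"
    and f: "\<And>i x y s. i \<in> E \<Longrightarrow> f i (\<lambda>v. x v + s * y v) = f i x + s * f i y"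
    and g: "\<And>x y s. g (\<lambda>v. x v + s * y v) = g x + s * g y"
    and ker: "\<And>x. (\<And>i. i \<in> E \<Longrightarrow> f i x = 0) \<Longrightarrow> g x = 0"
  shows "\<exists>l. \<forall>x. g x = (\<Sum>i\<in>E. l i * f i x)"
  using assms
proof (induction E arbitrary: g rule: finite_induct)
  case empty
  then show ?case by simp
next
  case (insert e E)
  show ?case
  proof (cases "\<forall>x. (\<forall>i\<in>E. f i x = 0) \<longrightarrow> f e x = 0")
    case True
    have "g x = 0" if "\<And>i. i \<in> E \<Longrightarrow> f i x = 0" for x
      using True that insert.prems(3)[of x] by blast
    then have "\<exists>l. \<forall>x. g x = (\<Sum>i\<in>E. l i * f i x)"
      using insert.prems by (intro insert.IH) auto
    then obtain l where l: "\<forall>x. g x = (\<Sum>i\<in>E. l i * f i x)" by blast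
    have "g x = (\<Sum>i\<in>insert e E. (l(e := 0)) i * f i x)" for x
    proof -
      have "(\<Sum>i\<in>E. (l(e := 0)) i * f i x) = (\<Sum>i\<in>E. l i * f i x)"
        using insert.hyps by (intro sum.cong) auto
      then show ?thesis using l insert.hyps by simp
    qed
    then show ?thesis by blast
  next
    case False
    then obtain u where u: "\<And>i. i \<in> E \<Longrightarrow> f i u = 0" "f e u \<noteq> 0" by blast
    define k where "k = g u / f e u"
    define g' where "g' x = g x - k * f e x" for x
    have "\<exists>l. \<forall>x. g' x = (\<Sum>i\<in>E. l i * f i x)"
    proof (rule insert.IH)
      show "f i (\<lambda>v. x v + s * y v) = f i x + s * f i y" if "i \<in> E" for i x y s
        using insert.prems(1) that by simp
      show "g' (\<lambda>v. x v + s * y v) = g' x + s * g' y" for x y s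
        using insert.prems(1)[of e] insert.prems(2) by (simp add: g'_def algebra_simps)
      fix x assume x: "\<And>i. i \<in> E \<Longrightarrow> f i x = 0"
      \<comment> \<open>Projection of \<open>x\<close> along \<open>u\<close> into the kernel of
        \<open>f e\<close>; the other functionals do not see the change.\<close>
      define x' where "x' = (\<lambda>v. x v + - (f e x / f e u) * u v)"
      have "g x' = 0"
      proof (rule insert.prems(3))
        show "f i x' = 0" if "i \<in> insert e E" for i
          using u x that insert.prems(1)[OF that, of x "- (f e x / f e u)" u] by (auto simp: x'_def)
      qed
      then have "g x = f e x / f e u * g u"
        using insert.prems(2)[of x "- (f e x / f e u)" u] by (simp add: x'_def)
      then show "g' x = 0" using u by (simp add: g'_def k_def)
    qed
    then obtain l where l: "\<forall>x. g' x = (\<Sum>i\<in>E. l i * f i x)" by blast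
    have "g x = (\<Sum>i\<in>insert e E. (l(e := k)) i * f i x)" for x
    proof -
      have "(\<Sum>i\<in>E. (l(e := k)) i * f i x) = (\<Sum>i\<in>E. l i * f i x)"
        using insert.hyps by (intro sum.cong) auto
      then show ?thesis using l insert.hyps by (simp add: g'_def algebra_simps)
    qed
    then show ?thesis by blast
  qed
qed

lemma quad_attains_min:
  fixes \<beta> :: real
  assumes fin: "finite V" and x0: "x0 \<in> feas V Cs"
    and bounded: "\<And>x v. x \<in> feas V Cs \<Longrightarrow> v \<in> V \<Longrightarrow> \<bar>x v\<bar> \<le> \<beta>"
  shows "\<exists>x\<in>feas V Cs. \<forall>y\<in>feas V Cs. quad V Q g x \<le> quad V Q g y"
proof -
  \<comment> \<open>Coordinates outside \<open>V\<close> are frozen at \<open>0\<close>. Left free,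
    they would destroy compactness in the product topology.\<close>
  define T where "T v = (if v \<in> V then {-\<beta>..\<beta>} else {0::real})" for v
  define S where "S = PiE UNIV T \<inter> feas V Cs"
  have cont: "continuous_on UNIV (\<lambda>x::'a \<Rightarrow> real. x v)" for v
    by (rule continuous_on_product_coordinates)
  have contlin: "continuous_on UNIV (lin V a)" for a
    unfolding lin_def by (intro continuous_intros cont)
  have contquad: "continuous_on UNIV (quad V Q g)"
    unfolding quad_def bil_def lin_def by (intro continuous_intros cont)
  have "compactin (product_topology (\<lambda>_. euclidean) UNIV) (PiE UNIV T)"
    unfolding compactin_PiE by (auto simp: T_def)
  then have "compact (PiE UNIV T)"
    by (simp add: euclidean_product_topology)
  moreover have "closed (feas V Cs)"
  proof -
    have "feas V Cs = (\<Inter>c\<in>Cs. {x. lin V (fst c) x \<le> real_of_int (snd c)})" by (simp add: feas_def INT_iff set_eq_iff)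
    moreover have "closed {x. lin V (fst c) x \<le> real_of_int (snd c)}" for c :: "('a \<Rightarrow> int) \<times> int"
      by (rule closed_Collect_le[OF contlin continuous_on_const])
    ultimately show ?thesis by auto
  qed
  ultimately have comp: "compact S" unfolding S_def by (rule compact_Int_closed)
  define \<pi> where "\<pi> y = (\<lambda>v. if v \<in> V then y v else (0::real))" for y
  have \<pi>S: "\<pi> y \<in> S" and \<pi>q: "quad V Q g (\<pi> y) = quad V Q g y" if y: "y \<in> feas V Cs" for y
  proof -
    have "\<pi> y \<in> feas V Cs" using y feas_cong[of V "\<pi> y" y] by (simp add: \<pi>_def)
    moreover have "\<pi> y v \<in> T v" for v
      using bounded[OF y, of v] by (auto simp: T_def \<pi>_def abs_le_iff)
    ultimately show "\<pi> y \<in> S" by (auto simp: S_def)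
    show "quad V Q g (\<pi> y) = quad V Q g y" by (rule quad_cong) (simp add: \<pi>_def)
  qed
  obtain x where "x \<in> S" "\<forall>y\<in>S. quad V Q g x \<le> quad V Q g y"
    using continuous_attains_inf[OF comp, of "quad V Q g"] \<pi>S[OF x0] contquad
    by (metis continuous_on_subset empty_iff subset_UNIV)
  then show ?thesis using \<pi>S \<pi>q by (metis IntD2 S_def)
qed

text \<open>The ratio test of the simplex method: among the constraints that increase along
  \<open>y\<close>, the one with the smallest ratio of slack to growth becomes tight first.\<close>

lemma ray_hits_constraint:
  assumes "finite Cs" "x \<in> feas V Cs" "c0 \<in> Cs" "lin V (fst c0) y > 0"
  obtains s c where "s \<ge> 0" "(\<lambda>v. x v + s * y v) \<in> feas V Cs" "c \<in> Cs" "lin V (fst c) y > 0"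
    "lin V (fst c) (\<lambda>v. x v + s * y v) = real_of_int (snd c)"
proof -
  define Cp where "Cp = {c\<in>Cs. lin V (fst c) y > 0}"
  define r where "r c = (real_of_int (snd c) - lin V (fst c) x) / lin V (fst c) y" for c
  have Cp: "finite Cp" "Cp \<noteq> {}" using assms unfolding Cp_def by (simp, blast)
  obtain c where c: "c \<in> Cp" "\<And>c'. c' \<in> Cp \<Longrightarrow> r c \<le> r c'"
    using arg_min_if_finite[OF Cp, of r] by (metis not_le)
  have r0: "r c \<ge> 0" using c(1) assms(2) by (auto simp: r_def Cp_def feas_def)
  show thesis
  proof (rule that[of "r c" c])
    show "(\<lambda>v. x v + r c * y v) \<in> feas V Cs"
      unfolding feas_def mem_Collect_eq lin_add lin_scale
    proof
      fix c' assume c': "c' \<in> Cs"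
      show "lin V (fst c') x + r c * lin V (fst c') y \<le> real_of_int (snd c')"
      proof (cases "c' \<in> Cp")
        case True
        then have "r c * lin V (fst c') y \<le> r c' * lin V (fst c') y"
          using c(2) by (intro mult_right_mono) (auto simp: Cp_def)
        also have "\<dots> = real_of_int (snd c') - lin V (fst c') x" using True by (simp add: r_def Cp_def)
        finally show ?thesis by simp
      next
        case False
        then have "r c * lin V (fst c') y \<le> 0"
          using c' r0 by (auto simp: Cp_def mult_nonneg_nonpos)
        then show ?thesis using assms(2) c' by (force simp: feas_def)
      qed
    qed
    show "lin V (fst c) (\<lambda>v. x v + r c * y v) = real_of_int (snd c)"
      using c(1) unfolding lin_add lin_scale by (simp add: r_def Cp_def)
  qed (use r0 c in \<open>auto simp: Cp_def\<close>)
qed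

text \<open>A first-order condition without derivatives: a step \<open>r\<close> against the sign of
  \<open>G\<close>, with \<open>r\<close> at most
  \<open>\<bar>G\<bar> / (2 * (\<bar>K\<bar> + 1))\<close>, lets the linear term outweigh the
  quadratic one.\<close>

lemma linear_coeff_zero:
  fixes d G K :: real
  assumes "d > 0" and nonneg: "\<And>s. \<bar>s\<bar> < d \<Longrightarrow> 0 \<le> s * G + s\<^sup>2 * K"
  shows "G = 0"
proof (rule ccontr)
  assume G: "G \<noteq> 0"
  define r where "r = min (d / 2) (\<bar>G\<bar> / (2 * (\<bar>K\<bar> + 1)))"
  have r: "r > 0" "r < d" using assms(1) G by (auto simp: r_def)
  have "r * (2 * (\<bar>K\<bar> + 1)) \<le> \<bar>G\<bar>"
    using min.cobounded2[of "d/2" "\<bar>G\<bar> / (2 * (\<bar>K\<bar> + 1))"]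
    unfolding r_def[symmetric] by (subst (asm) pos_le_divide_eq) auto
  then have "2 * (r * \<bar>K\<bar>) < \<bar>G\<bar>" using r by (simp add: algebra_simps)
  then have "r * (r * \<bar>K\<bar>) < r * \<bar>G\<bar>"
    using r by (intro mult_strict_left_mono) (auto intro: le_less_trans[rotated])
  moreover have "r * (r * K) \<le> r * (r * \<bar>K\<bar>)" using r by (intro mult_left_mono) auto
  moreover have "0 \<le> (- sgn G * r) * G + (- sgn G * r)\<^sup>2 * K"
    using r G by (intro nonneg) (auto simp: abs_mult abs_sgn_eq)
  moreover have "(- sgn G * r) * G = - (r * \<bar>G\<bar>)" by (simp add: abs_sgn)
  moreover have "(- sgn G * r)\<^sup>2 * K = r * (r * K)"
    using G by (auto simp: power2_eq_square sgn_if)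
  ultimately show False by linarith
qed

text \<open>Exponent of the linear-system bound for a square system with at most \<open>N\<close>
  unknowns and entries up to \<open>2 ^ (\<beta> + 1)\<close>: each factor \<open>k + 1\<close> is
  replaced by \<open>2 ^ N\<close>, and the squared entry bound contributes
  \<open>2 * \<beta> + 2\<close>.\<close>

definition qp_exp :: "nat \<Rightarrow> nat \<Rightarrow> nat" where
  "qp_exp N \<beta> = (2 * N + 2 * \<beta> + 2) * N"

lemma qp_exp_bound:
  assumes "k \<le> N"
  shows "((k + 1) * ((k + 1) * (2 ^ (\<beta> + 1))\<^sup>2)) ^ k \<le> (2::nat) ^ qp_exp N \<beta>"
proof -
  have N: "k + 1 \<le> 2 ^ N" using assms less_exp[of N] by linarith
  have "(k + 1) * ((k + 1) * (2 ^ (\<beta> + 1))\<^sup>2) \<le> 2 ^ N * (2 ^ N * (2 ^ (\<beta> + 1))\<^sup>2)"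
    using N by (intro mult_mono) auto
  also have "\<dots> = 2 ^ (2 * N + 2 * \<beta> + 2)"
    by (simp flip: power_add power_mult add: algebra_simps)
  finally have "((k + 1) * ((k + 1) * (2 ^ (\<beta> + 1))\<^sup>2)) ^ k \<le> (2 ^ (2 * N + 2 * \<beta> + 2)) ^ k"
    by (rule power_mono) simp
  also have "\<dots> \<le> (2 ^ (2 * N + 2 * \<beta> + 2)) ^ N"
    using assms by (intro power_increasing) auto
  finally show ?thesis by (simp only: power_mult qp_exp_def)
qed

text \<open>Among the minimisers take one with the largest active set. Its first-order conditions,
  with multipliers as additional unknowns, form an integer linear system whose \<open>x\<close>-part is unique:
  along the difference of two solutions the objective would be constant, and following it until
  it meets a further constraint would enlarge the active set.\<close>

lemma qp_small_minimizer:
  fixes V :: "'v set" and \<gamma> :: real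
  assumes fin: "finite V" "finite Cs" and N: "card V + card Cs \<le> N"
    and Q: "\<And>u v. u \<in> V \<Longrightarrow> v \<in> V \<Longrightarrow> \<bar>Q u v\<bar> \<le> 2 ^ \<beta>"
    and g: "\<And>v. v \<in> V \<Longrightarrow> \<bar>g v\<bar> \<le> 2 ^ \<beta>"
    and C: "\<And>c v. c \<in> Cs \<Longrightarrow> v \<in> V \<Longrightarrow> \<bar>fst c v\<bar> \<le> 2 ^ \<beta>" "\<And>c. c \<in> Cs \<Longrightarrow> \<bar>snd c\<bar> \<le> 2 ^ \<beta>"
    and x0: "x0 \<in> feas V Cs"
    and bounded: "\<And>x v. x \<in> feas V Cs \<Longrightarrow> v \<in> V \<Longrightarrow> \<bar>x v\<bar> \<le> \<gamma>"
  obtains t :: int and n :: "'v \<Rightarrow> int" where "t \<ge> 1" "t \<le> 2 ^ qp_exp N \<beta>"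
    "\<And>v. \<bar>n v\<bar> \<le> 2 ^ qp_exp N \<beta>" "(\<lambda>v. n v / t) \<in> feas V Cs"
    "\<And>y. y \<in> feas V Cs \<Longrightarrow> quad V Q g (\<lambda>v. n v / t) \<le> quad V Q g y"
proof -
  define opt where "opt x \<longleftrightarrow> x \<in> feas V Cs \<and> (\<forall>y\<in>feas V Cs. quad V Q g x \<le> quad V Q g y)" for x
  define act where "act x = {c\<in>Cs. lin V (fst c) x = real_of_int (snd c)}" for x
  obtain x1 where "opt x1"
    using quad_attains_min[OF fin(1) x0, of \<gamma>] bounded unfolding opt_def by blast
  moreover have "card (act y) < Suc (card Cs)" for y
    using fin by (simp add: act_def card_mono less_Suc_eq_le)
  ultimately obtain x where x: "opt x" and max: "\<And>y. opt y \<Longrightarrow> card (act y) \<le> card (act x)"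
    using ex_has_greatest_nat[of opt x1 "\<lambda>x. card (act x)" "Suc (card Cs)"] by blast
  define E where "E = act x"
  have E: "E \<subseteq> Cs" "finite E" using fin by (auto simp: E_def act_def)
  have Eact: "lin V (fst c) x = real_of_int (snd c)" if "c \<in> E" for c using that by (simp add: E_def act_def)
  have xf: "x \<in> feas V Cs" using x by (simp add: opt_def)
  have stationary: "dquad V Q g x y = 0" if y: "\<And>c. c \<in> E \<Longrightarrow> lin V (fst c) y = 0" for y
  proof -
    \<comment> \<open>Active constraints stay constant along \<open>y\<close> and slack ones survive
      short steps, so \<open>x\<close> can be moved in both directions.\<close>
    have "eventually (\<lambda>s. lin V (fst c) x + s * lin V (fst c) y \<le> real_of_int (snd c)) (nhds 0)" if c: "c \<in> Cs" for c
    proof (cases "c \<in> E")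
      case True
      then show ?thesis using y Eact by simp
    next
      case False
      then have "lin V (fst c) x < real_of_int (snd c)"
        using c xf by (auto simp: E_def act_def feas_def order.order_iff_strict)
      moreover have "((\<lambda>s. lin V (fst c) x + s * lin V (fst c) y) \<longlongrightarrow> lin V (fst c) x + 0 * lin V (fst c) y) (nhds 0)"
        by (intro tendsto_intros filterlim_ident)
      ultimately have "eventually (\<lambda>s. lin V (fst c) x + s * lin V (fst c) y < real_of_int (snd c)) (nhds 0)"
        by (intro order_tendstoD(2)) auto
      then show ?thesis by (rule eventually_mono) simp
    qed
    then have "eventually (\<lambda>s. \<forall>c\<in>Cs. lin V (fst c) x + s * lin V (fst c) y \<le> real_of_int (snd c)) (nhds 0)"
      using fin by (simp add: eventually_ball_finite)
    then obtain d where d: "d > 0" "\<And>s. \<bar>s\<bar> < d \<Longrightarrow> \<forall>c\<in>Cs. lin V (fst c) x + s * lin V (fst c) y \<le> real_of_int (snd c)"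
      by (auto simp: eventually_nhds_metric dist_real_def)
    show ?thesis
    proof (rule linear_coeff_zero[OF d(1)])
      fix s :: real assume "\<bar>s\<bar> < d"
      then have "(\<lambda>v. x v + s * y v) \<in> feas V Cs"
        using d(2) by (simp add: feas_def lin_add lin_scale)
      then have "quad V Q g x \<le> quad V Q g (\<lambda>v. x v + s * y v)" using x by (simp add: opt_def)
      then show "0 \<le> s * dquad V Q g x y + s\<^sup>2 * bil V Q y y" by (simp add: quad_line)
    qed
  qed
  obtain l where l: "\<And>y. dquad V Q g x y = (\<Sum>c\<in>E. l c * lin V (fst c) y)"
    using functional_in_span[OF E(2), of "\<lambda>c. lin V (fst c)" "dquad V Q g x"] stationary
    by (auto simp: lin_add lin_scale dquad_add dquad_scale)
  \<comment> \<open>The gradient involves the symmetrised matrix. Its entries may be twice as large,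
    whence the bound \<open>2 ^ (\<beta> + 1)\<close> for the system.\<close>
  define S where "S u v = Q u v + Q v u" for u v
  have unit: "(\<Sum>v\<in>V. f v * (if v = u then 1 else 0)) = f u" if "u \<in> V" for f :: "'v \<Rightarrow> real" and u
    using that fin by (simp add: if_distrib[of "(*) _"] cong: if_cong)
  have unit': "(\<Sum>v\<in>V. (if v = u then 1 else 0) * f v) = f u" if "u \<in> V" for f :: "'v \<Rightarrow> real" and u
    using unit[OF that, of f] by (simp add: mult.commute)
  have kkt: "(\<Sum>v\<in>V. S u v * x v) - (\<Sum>c\<in>E. fst c u * l c) = - g u" if u: "u \<in> V" for u
  proof -
    have "dquad V Q g x (\<lambda>v. if v = u then 1 else 0) = (\<Sum>v\<in>V. S u v * x v) + g u"
      unfolding dquad_def bil_def lin_def unit[OF u]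
      by (subst sum.swap) (simp add: unit[OF u] unit'[OF u] S_def sum.distrib distrib_right
          mult.commute[of "real_of_int _"] mult.assoc sum_distrib_left[symmetric])
    moreover have "lin V (fst c) (\<lambda>v. if v = u then 1 else 0) = fst c u" for c :: "('v \<Rightarrow> int) \<times> int"
      unfolding lin_def by (rule unit[OF u])
    ultimately show ?thesis using l[of "\<lambda>v. if v = u then 1 else 0"] by (simp add: mult.commute)
  qed
  define W where "W = V <+> E"
  \<comment> \<open>First-order system: unknowns \<open>Inl v\<close> are coordinates and
    \<open>Inr c\<close> multipliers; rows \<open>Inl u\<close> express stationarity and rows
    \<open>Inr c\<close> tightness of the active constraints.\<close>
  define G where "G = (\<lambda>(r :: 'v + ('v \<Rightarrow> int) \<times> int) (s :: 'v + ('v \<Rightarrow> int) \<times> int). case r of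
      Inl u \<Rightarrow> (case s of Inl v \<Rightarrow> S u v | Inr c \<Rightarrow> - fst c u)
    | Inr c \<Rightarrow> (case s of Inl v \<Rightarrow> fst c v | Inr _ \<Rightarrow> 0))"
  define k where "k = (\<lambda>r :: 'v + ('v \<Rightarrow> int) \<times> int. case r of Inl u \<Rightarrow> - g u | Inr c \<Rightarrow> snd c)"
  define X where "X = (\<lambda>s :: 'v + ('v \<Rightarrow> int) \<times> int. case s of Inl v \<Rightarrow> x v | Inr c \<Rightarrow> l c)"
  have sumW: "(\<Sum>s\<in>W. f s) = (\<Sum>v\<in>V. f (Inl v)) + (\<Sum>c\<in>E. f (Inr c))" for f :: "_ \<Rightarrow> real"
    using fin E by (simp add: W_def sum.Plus)
  have finW: "finite W" using fin E by (simp add: W_def)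
  have "card W = card V + card E" using fin E by (simp add: W_def card_Plus)
  also have "\<dots> \<le> N" using N E fin card_mono[of Cs E] by linarith
  finally have cW: "card W \<le> N" .
  have Gb: "\<bar>G r s\<bar> \<le> int (2 ^ (\<beta> + 1))" if "r \<in> W" "s \<in> W" for r s
  proof -
    have "\<bar>S u v\<bar> \<le> 2 ^ \<beta> + 2 ^ \<beta>" if "u \<in> V" "v \<in> V" for u v
      using Q[OF that] Q[OF that(2,1)] unfolding S_def by linarith
    moreover have "\<bar>fst c v\<bar> \<le> 2 * 2 ^ \<beta>" if "c \<in> E" "v \<in> V" for c v
      using order_trans[OF C(1)[of c v], of "2 * 2 ^ \<beta>"] that E by auto
    ultimately show ?thesis using that by (auto simp: W_def G_def split: sum.split)
  qed
  have kb: "\<bar>k r\<bar> \<le> int (2 ^ (\<beta> + 1))" if "r \<in> W" for r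
  proof -
    have "\<bar>g v\<bar> \<le> 2 * 2 ^ \<beta>" if "v \<in> V" for v
      using order_trans[OF g[OF that], of "2 * 2 ^ \<beta>"] by auto
    moreover have "\<bar>snd c\<bar> \<le> 2 * 2 ^ \<beta>" if "c \<in> E" for c
      using order_trans[OF C(2)[of c], of "2 * 2 ^ \<beta>"] that E by auto
    ultimately show ?thesis using that by (auto simp: W_def k_def split: sum.split)
  qed
  have sol: "(\<Sum>s\<in>W. G r s * X s) = k r" if "r \<in> W" for r
    using that kkt Eact unfolding sumW
    by (auto simp: W_def G_def X_def k_def lin_def sum_negf)
  obtain t n where tn: "t \<ge> 1" "t \<le> int (((card W + 1) * ((card W + 1) * (2 ^ (\<beta> + 1))\<^sup>2)) ^ card W)"
    "\<And>s. \<bar>n s\<bar> \<le> int (((card W + 1) * ((card W + 1) * (2 ^ (\<beta> + 1))\<^sup>2)) ^ card W)"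
    "\<And>r. r \<in> W \<Longrightarrow> (\<Sum>s\<in>W. G r s * (n s / t)) = k r"
    by (rule linear_system_small_solution[of W W "2 ^ (\<beta> + 1)" G k X]) (use finW Gb kb sol in auto)
  have K: "int (((card W + 1) * ((card W + 1) * (2 ^ (\<beta> + 1))\<^sup>2)) ^ card W) \<le> 2 ^ qp_exp N \<beta>"
    using qp_exp_bound[OF cW, of \<beta>] by (metis of_nat_le_iff of_nat_numeral of_nat_power)
  \<comment> \<open>The small solution of the system is not known to be \<open>x\<close>; the rest
    of the proof shows that its coordinate part agrees with \<open>x\<close> on
    \<open>V\<close>.\<close>
  define y where "y v = n (Inl v) / t" for v
  define \<eta> where "\<eta> v = y v - x v" for v
  define \<nu> where "\<nu> c = n (Inr c) / t - l c" for c
  have \<eta>E: "lin V (fst c) \<eta> = 0" if "c \<in> E" for c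
  proof -
    have "Inr c \<in> W" using that by (auto simp: W_def)
    then have "lin V (fst c) y = real_of_int (snd c)"
      using tn(4)[of "Inr c"] unfolding sumW by (simp add: G_def k_def lin_def y_def)
    then show ?thesis using Eact[OF that] by (simp add: \<eta>_def[abs_def] lin_diff)
  qed
  have S\<eta>: "(\<Sum>v\<in>V. S u v * \<eta> v) = (\<Sum>c\<in>E. \<nu> c * fst c u)" if "u \<in> V" for u
  proof -
    have "Inl u \<in> W" using that by (auto simp: W_def)
    then have "(\<Sum>v\<in>V. S u v * y v) - (\<Sum>c\<in>E. fst c u * (n (Inr c) / t)) = - g u"
      using tn(4)[of "Inl u"] unfolding sumW by (simp add: G_def k_def y_def sum_negf)
    then have "(\<Sum>v\<in>V. S u v * y v) - (\<Sum>v\<in>V. S u v * x v)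
        = (\<Sum>c\<in>E. fst c u * (n (Inr c) / t)) - (\<Sum>c\<in>E. fst c u * l c)"
      using kkt[OF that] by linarith
    then show ?thesis
      by (simp add: \<eta>_def \<nu>_def right_diff_distrib left_diff_distrib sum_subtractf mult.commute)
  qed
  \<comment> \<open>The stationarity rows express the symmetrised matrix applied to
    \<open>\<eta>\<close> by the active constraints, which vanish on \<open>\<eta>\<close>; hence
    there is no curvature along \<open>\<eta>\<close>.\<close>
  have "2 * bil V Q \<eta> \<eta> = (\<Sum>u\<in>V. \<eta> u * (\<Sum>v\<in>V. S u v * \<eta> v))"
  proof -
    have "bil V Q \<eta> \<eta> = (\<Sum>u\<in>V. \<Sum>v\<in>V. Q v u * \<eta> u * \<eta> v)"
      unfolding bil_def by (subst sum.swap) (simp add: mult_ac)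
    then have "2 * bil V Q \<eta> \<eta> = bil V Q \<eta> \<eta> + (\<Sum>u\<in>V. \<Sum>v\<in>V. Q v u * \<eta> u * \<eta> v)" by simp
    also have "\<dots> = (\<Sum>u\<in>V. \<eta> u * (\<Sum>v\<in>V. S u v * \<eta> v))"
      by (simp add: bil_def S_def sum_distrib_left distrib_right distrib_left sum.distrib mult_ac)
    finally show ?thesis .
  qed
  also have "\<dots> = (\<Sum>u\<in>V. \<eta> u * (\<Sum>c\<in>E. \<nu> c * fst c u))" using S\<eta> by simp
  also have "\<dots> = (\<Sum>c\<in>E. \<nu> c * lin V (fst c) \<eta>)"
    by (simp add: lin_def sum_distrib_left sum.swap[of _ V E] mult_ac)
  also have "\<dots> = 0" using \<eta>E by simp
  finally have bil0: "bil V Q \<eta> \<eta> = 0" by simp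
  have const: "quad V Q g (\<lambda>v. x v + s * \<eta> v) = quad V Q g x" for s
    using stationary[OF \<eta>E] bil0 by (simp add: quad_line)
  have "\<eta> v = 0" if v: "v \<in> V" for v
  proof (rule ccontr)
    assume nz: "\<eta> v \<noteq> 0"
    have "\<exists>c0\<in>Cs. lin V (fst c0) \<eta> > 0"
    proof (rule ccontr)
      assume *: "\<not> ?thesis"
      \<comment> \<open>A step long enough to push coordinate \<open>v\<close> beyond
        \<open>\<gamma>\<close>; if no constraint grew along \<open>\<eta>\<close>, the point
        reached would still be feasible.\<close>
      define s where "s = (\<gamma> + \<bar>x v\<bar> + 1) / \<bar>\<eta> v\<bar>"
      have "\<gamma> \<ge> 0" using bounded[OF xf v] by linarith
      then have s: "s \<ge> 0" by (simp add: s_def)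
      have "(\<lambda>v. x v + s * \<eta> v) \<in> feas V Cs"
        unfolding feas_def mem_Collect_eq lin_add lin_scale
      proof
        fix c assume c: "c \<in> Cs"
        then have "s * lin V (fst c) \<eta> \<le> 0" using * s by (auto simp: not_less mult_nonneg_nonpos)
        moreover have "lin V (fst c) x \<le> real_of_int (snd c)" using xf c by (simp add: feas_def)
        ultimately show "lin V (fst c) x + s * lin V (fst c) \<eta> \<le> real_of_int (snd c)" by simp
      qed
      then have "\<bar>x v + s * \<eta> v\<bar> \<le> \<gamma>" using bounded v by blast
      moreover have "\<bar>s * \<eta> v\<bar> = \<gamma> + \<bar>x v\<bar> + 1"
        using nz \<open>\<gamma> \<ge> 0\<close> by (simp add: s_def abs_mult)
      ultimately show False by linarith
    qed
    then obtain c0 where c0: "c0 \<in> Cs" "lin V (fst c0) \<eta> > 0" by blast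
    obtain s c where sc: "s \<ge> 0" "(\<lambda>v. x v + s * \<eta> v) \<in> feas V Cs" "c \<in> Cs" "lin V (fst c) \<eta> > 0"
        "lin V (fst c) (\<lambda>v. x v + s * \<eta> v) = real_of_int (snd c)"
      using ray_hits_constraint[OF fin(2) xf c0] by blast
    define x' where "x' = (\<lambda>v. x v + s * \<eta> v)"
    have "opt x'" using x sc(2) const[of s] by (simp add: opt_def x'_def)
    moreover have "E \<subset> act x'"
    proof
      show "E \<subseteq> act x'" using E \<eta>E Eact by (auto simp: act_def x'_def lin_add lin_scale)
      have "c \<in> act x'" "c \<notin> E" using sc \<eta>E[of c] by (auto simp: act_def x'_def)
      then show "E \<noteq> act x'" by blast
    qed
    moreover have "finite (act x')" using fin by (simp add: act_def)
    ultimately show False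
      using max[of x'] psubset_card_mono[of "act x'" E] by (simp add: E_def)
  qed
  then have yx: "y v = x v" if "v \<in> V" for v using that by (simp add: \<eta>_def)
  show thesis
  proof (rule that[of t "\<lambda>v. n (Inl v)"])
    show "t \<ge> 1" "t \<le> 2 ^ qp_exp N \<beta>" "\<bar>n (Inl v)\<bar> \<le> 2 ^ qp_exp N \<beta>" for v
      using tn(1) order_trans[OF tn(2) K] order_trans[OF tn(3) K] by auto
    show "(\<lambda>v. n (Inl v) / t) \<in> feas V Cs"
      using feas_cong[of V y x Cs] yx xf by (simp add: y_def[abs_def])
    show "quad V Q g (\<lambda>v. n (Inl v) / t) \<le> quad V Q g z" if "z \<in> feas V Cs" for z
      using quad_cong[of V y x Q g] yx x that by (simp add: y_def[abs_def] opt_def)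
  qed
qed

section \<open>Polyhedra and their recession cones\<close>

lemma lin_of_int: "lin V a (\<lambda>v. real_of_int (y v)) = real_of_int (\<Sum>v\<in>V. a v * y v)"
  by (simp add: lin_def)

lemma bil_of_int:
  "bil V Q (\<lambda>v. real_of_int (x v)) (\<lambda>v. real_of_int (y v)) = real_of_int (\<Sum>u\<in>V. \<Sum>v\<in>V. Q u v * x u * y v)"
  by (simp add: bil_def)

lemma lin_zero_left: "lin V (\<lambda>v. 0) x = 0"
  by (simp add: lin_def)

text \<open>A quantitative Caratheodory argument. The orthant condition makes the cone pointed and
  its slice \<open>lin V s = 1\<close> bounded, so the face of \<open>u\<close> contains a small
  point of the slice, found by minimising the zero function. Subtracting the largest admissible
  multiple of it from \<open>u\<close> keeps the tight constraints tight and adds a new one; the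
  number of slack constraints drives the induction and bounds \<open>k\<close>.\<close>

lemma cone_decomposition:
  fixes V :: "'v set" and As :: "('v \<Rightarrow> int) set"
  assumes fin: "finite V" "finite As" and N: "card V + 2 * card As + 2 \<le> N"
    and coeff: "\<And>a v. a \<in> As \<Longrightarrow> v \<in> V \<Longrightarrow> \<bar>a v\<bar> \<le> 2 ^ \<beta>"
    and s: "\<And>v. v \<in> V \<Longrightarrow> \<bar>s v\<bar> = 1"
    and orthant: "\<And>u v. (\<And>a. a \<in> As \<Longrightarrow> lin V a u \<le> 0) \<Longrightarrow> v \<in> V \<Longrightarrow> 0 \<le> real_of_int (s v) * u v"
    and u: "\<And>a. a \<in> As \<Longrightarrow> lin V a u \<le> 0"
  shows "\<exists>k R l. k \<le> card {a\<in>As. lin V a u \<noteq> 0} \<and>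
    (\<forall>i<k. 0 \<le> l i \<and> (\<forall>a\<in>As. lin V a (\<lambda>v. real_of_int (R i v)) \<le> 0) \<and> (\<forall>v. \<bar>R i v\<bar> \<le> 2 ^ qp_exp N \<beta>)) \<and>
    (\<forall>v\<in>V. u v = (\<Sum>i<k. l i * real_of_int (R i v)))"
  using u
proof (induction "card {a\<in>As. lin V a u \<noteq> 0}" arbitrary: u rule: less_induct)
  case less
  note u = less.prems
  show ?case
  proof (cases "\<forall>v\<in>V. u v = 0")
    case True
    then show ?thesis by (intro exI[of _ 0]) auto
  next
    case False
    have sgn: "real_of_int (s v) = 1 \<or> real_of_int (s v) = -1" if "v \<in> V" for v
      using s[OF that] by auto
    define \<sigma> where "\<sigma> = lin V s u"
    have nn: "0 \<le> real_of_int (s v) * u v" if "v \<in> V" for v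
      using orthant[of u v] u that by blast
    have \<sigma>: "\<sigma> > 0"
    proof -
      obtain v where v: "v \<in> V" "u v \<noteq> 0" using False by blast
      then have "0 < real_of_int (s v) * u v" using sgn[OF v(1)] nn[OF v(1)] by auto
      then show ?thesis unfolding \<sigma>_def lin_def using fin(1) v(1) nn by (intro sum_pos2) auto
    qed
    define E where "E = {a\<in>As. lin V a u = 0}"
    \<comment> \<open>The opposite inequalities for \<open>E\<close> restrict to the face of
      \<open>u\<close>; the last two constraints cut out the slice.\<close>
    define Cs where "Cs = (\<lambda>a. (a, 0::int)) ` As \<union> (\<lambda>a. (\<lambda>v. - a v, 0)) ` E \<union> {(s, 1), (\<lambda>v. - s v, -1)}"
    have finE: "finite E" using fin by (simp add: E_def)
    have finCs: "finite Cs" using fin finE by (simp add: Cs_def)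
    have "card Cs \<le> card ((\<lambda>a. (a, 0::int)) ` As) + card ((\<lambda>a. (\<lambda>v. - a v, 0::int)) ` E) + card {(s, 1::int), (\<lambda>v. - s v, -1)}"
      unfolding Cs_def by (meson add_le_mono1 card_Un_le order_trans)
    also have "\<dots> \<le> card As + card E + 2"
      using card_image_le[OF fin(2), of "\<lambda>a. (a, 0::int)"] card_image_le[OF finE, of "\<lambda>a. (\<lambda>v. - a v, 0::int)"]
      by (simp add: card_insert_if)
    also have "card E \<le> card As" unfolding E_def using fin by (intro card_mono) auto
    finally have cCs: "card V + card Cs \<le> N" using N by simp
    have feasCs: "x \<in> feas V Cs \<longleftrightarrow> (\<forall>a\<in>As. lin V a x \<le> 0) \<and> (\<forall>a\<in>E. lin V a x \<ge> 0) \<and> lin V s x = 1" for x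
      unfolding feas_def Cs_def mem_Collect_eq ball_Un ball_simps by (auto simp: lin_minus)
    have x0: "(\<lambda>v. (1 / \<sigma>) * u v) \<in> feas V Cs"
      unfolding feasCs lin_scale using u \<sigma> by (auto simp: E_def \<sigma>_def[symmetric] divide_nonpos_pos)
    have bounded: "\<bar>x v\<bar> \<le> 1" if x: "x \<in> feas V Cs" and v: "v \<in> V" for x v
    proof -
      have nn: "0 \<le> real_of_int (s v) * x v" if "v \<in> V" for v
        using orthant[of x v] x that by (auto simp: feasCs)
      have "\<bar>x v\<bar> = real_of_int (s v) * x v" using sgn[OF v] nn[OF v] by auto
      also have "\<dots> \<le> lin V s x"
        unfolding lin_def using fin(1) v nn by (intro member_le_sum) auto
      finally show ?thesis using x by (simp add: feasCs)
    qed
    obtain t n where t: "t \<ge> 1" and n: "\<And>v. \<bar>n v\<bar> \<le> 2 ^ qp_exp N \<beta>"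
      and nf: "(\<lambda>v. real_of_int (n v) / real_of_int t) \<in> feas V Cs"
    proof (rule qp_small_minimizer[OF fin(1) finCs cCs,
          where Q = "\<lambda>_ _. 0" and g = "\<lambda>_. 0" and \<beta> = \<beta> and \<gamma> = 1])
      show "(\<lambda>v. (1 / \<sigma>) * u v) \<in> feas V Cs" by (rule x0)
      show "\<bar>x v\<bar> \<le> 1" if "x \<in> feas V Cs" "v \<in> V" for x v using bounded that by blast
      show "\<bar>fst c v\<bar> \<le> 2 ^ \<beta>" if "c \<in> Cs" "v \<in> V" for c v
        using that coeff s by (auto simp: Cs_def E_def)
      show "\<bar>snd c\<bar> \<le> 2 ^ \<beta>" if "c \<in> Cs" for c using that by (auto simp: Cs_def)
    qed auto
    \<comment> \<open>Directions may be rescaled, so the denominator is dropped and the numerators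
      form an integral ray.\<close>
    define y where "y v = real_of_int (n v)" for v
    have y: "y = (\<lambda>v. real_of_int t * (real_of_int (n v) / real_of_int t))"
      using t by (auto simp: y_def)
    have yA: "lin V a y \<le> 0" if "a \<in> As" for a
      unfolding y lin_scale using nf t that by (auto simp: feasCs mult_nonneg_nonpos)
    have yE: "lin V a y = 0" if "a \<in> E" for a
    proof -
      have "a \<in> As" using that by (simp add: E_def)
      then show ?thesis
        unfolding y lin_scale using nf that by (force simp: feasCs intro: antisym)
    qed
    have ys: "lin V s y > 0"
      unfolding y lin_scale using nf t by (auto simp: feasCs)
    \<comment> \<open>Otherwise the cone would contain the opposite of \<open>y\<close> as well,
      which the orthant condition and \<open>lin V s y > 0\<close> exclude.\<close>
    have "\<exists>a\<in>As. lin V a y < 0"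
    proof (rule ccontr)
      assume "\<not> ?thesis"
      then have "lin V a (\<lambda>v. (-1) * y v) \<le> 0" if "a \<in> As" for a
        unfolding lin_scale using that by auto
      then have "0 \<le> real_of_int (s v) * ((-1) * y v)" if "v \<in> V" for v
        using orthant that by blast
      then have "0 \<le> lin V s (\<lambda>v. (-1) * y v)" unfolding lin_def by (intro sum_nonneg) auto
      then show False using ys unfolding lin_scale by simp
    qed
    then obtain a0 where a0: "a0 \<in> As" "lin V a0 y < 0" by blast
    define C0 where "C0 = (\<lambda>a. (a, 0::int)) ` As"
    have feasC0: "x \<in> feas V C0 \<longleftrightarrow> (\<forall>a\<in>As. lin V a x \<le> 0)" for x
      by (auto simp: feas_def C0_def)
    obtain r c where rc: "r \<ge> 0" "(\<lambda>v. u v + r * ((-1) * y v)) \<in> feas V C0" "c \<in> C0"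
       "lin V (fst c) (\<lambda>v. (-1) * y v) > 0"
       "lin V (fst c) (\<lambda>v. u v + r * ((-1) * y v)) = real_of_int (snd c)"
    proof (rule ray_hits_constraint[of C0 u V "(a0, 0)" "\<lambda>v. (-1) * y v"])
      show "finite C0" using fin by (simp add: C0_def)
      show "u \<in> feas V C0" using u by (simp add: feasC0)
      show "(a0, 0) \<in> C0" using a0 by (simp add: C0_def)
      show "0 < lin V (fst (a0, 0)) (\<lambda>v. -1 * y v)" unfolding lin_scale using a0 by simp
    qed
    define u' where "u' = (\<lambda>v. u v + r * ((-1) * y v))"
    obtain a1 where a1: "a1 \<in> As" "lin V a1 y < 0" "lin V a1 u' = 0"
      using rc(3-5) unfolding lin_scale u'_def by (auto simp: C0_def)
    have u'A: "lin V a u' \<le> 0" if "a \<in> As" for a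
      using rc(2) that by (simp add: feasC0 u'_def)
    have "{a\<in>As. lin V a u' \<noteq> 0} \<subset> {a\<in>As. lin V a u \<noteq> 0}"
    proof
      show "{a\<in>As. lin V a u' \<noteq> 0} \<subseteq> {a\<in>As. lin V a u \<noteq> 0}"
        using yE unfolding u'_def lin_add lin_scale by (auto simp: E_def)
      have "lin V a1 u \<noteq> 0" using a1 yE by (auto simp: E_def)
      then show "{a\<in>As. lin V a u' \<noteq> 0} \<noteq> {a\<in>As. lin V a u \<noteq> 0}" using a1 by blast
    qed
    then have lt: "card {a\<in>As. lin V a u' \<noteq> 0} < card {a\<in>As. lin V a u \<noteq> 0}"
      using fin by (intro psubset_card_mono) auto
    obtain k R l where IH: "k \<le> card {a\<in>As. lin V a u' \<noteq> 0}"
        "\<forall>i<k. 0 \<le> l i \<and> (\<forall>a\<in>As. lin V a (\<lambda>v. real_of_int (R i v)) \<le> 0) \<and> (\<forall>v. \<bar>R i v\<bar> \<le> 2 ^ qp_exp N \<beta>)"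
        "\<forall>v\<in>V. u' v = (\<Sum>i<k. l i * real_of_int (R i v))"
      using less.hyps[OF lt u'A] by blast
    define R' where "R' = R(k := n)"
    define l' where "l' = l(k := r)"
    have "\<forall>v\<in>V. u v = (\<Sum>i<Suc k. l' i * real_of_int (R' i v))"
    proof
      fix v assume "v \<in> V"
      then have "u v = (\<Sum>i<k. l i * real_of_int (R i v)) + r * y v"
        using IH(3) by (simp add: u'_def algebra_simps)
      then show "u v = (\<Sum>i<Suc k. l' i * real_of_int (R' i v))"
        by (simp add: R'_def l'_def y_def)
    qed
    moreover have "\<forall>i<Suc k. 0 \<le> l' i \<and> (\<forall>a\<in>As. lin V a (\<lambda>v. real_of_int (R' i v)) \<le> 0) \<and> (\<forall>v. \<bar>R' i v\<bar> \<le> 2 ^ qp_exp N \<beta>)"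
      using IH(2) rc(1) yA n by (auto simp: R'_def l'_def y_def[abs_def] less_Suc_eq)
    ultimately show ?thesis using IH(1) lt by (intro exI[of _ "Suc k"]) auto
  qed
qed

text \<open>Only integral directions are considered: moving by natural multiples of them preserves
  integrality of coordinates.\<close>

definition recession :: "'v set \<Rightarrow> (('v \<Rightarrow> int) \<times> int) set \<Rightarrow> ('v \<Rightarrow> int) \<Rightarrow> bool" where
  "recession V Cs r \<longleftrightarrow> (\<forall>c\<in>Cs. lin V (fst c) (\<lambda>v. real_of_int (r v)) \<le> 0)"

text \<open>The homogenised polyhedron, cut with the orthant of \<open>(x, 1)\<close>, is a pointed cone; a generator
  of positive height enters \<open>(x, 1)\<close> with coefficient at most \<open>1\<close>, so only the generators of height
  \<open>0\<close> contribute an unbounded amount.\<close>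

lemma polyhedron_decomposition:
  fixes V :: "'v set" and x :: "'v \<Rightarrow> real"
  defines "e N \<beta> \<equiv> qp_exp (5 * N + 5) \<beta>"
  assumes fin: "finite V" "finite Cs" and N: "card V \<le> N" "card Cs \<le> N"
    and C: "\<And>c v. c \<in> Cs \<Longrightarrow> v \<in> V \<Longrightarrow> \<bar>fst c v\<bar> \<le> 2 ^ \<beta>" "\<And>c. c \<in> Cs \<Longrightarrow> \<bar>snd c\<bar> \<le> 2 ^ \<beta>"
    and x: "x \<in> feas V Cs"
  obtains I :: "nat set" and r :: "nat \<Rightarrow> 'v \<Rightarrow> int" and K :: "nat \<Rightarrow> nat" and z :: "'v \<Rightarrow> real" where
    "finite I" "card I \<le> 2 * N + 1" "\<And>i. i \<in> I \<Longrightarrow> recession V Cs (r i)"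
    "\<And>i v. i \<in> I \<Longrightarrow> \<bar>r i v\<bar> \<le> 2 ^ e N \<beta>"
    "z \<in> feas V Cs" "\<And>v. v \<in> V \<Longrightarrow> \<bar>z v\<bar> \<le> 2 ^ (2 * N + 1 + e N \<beta>)"
    "\<And>v. v \<in> V \<Longrightarrow> x v = z v + (\<Sum>i\<in>I. real (K i) * real_of_int (r i v))"
proof -
  define W where "W = insert None (Some ` V)"
  define X where "X w = (case w of None \<Rightarrow> 1 | Some v \<Rightarrow> x v)" for w
  \<comment> \<open>Sign pattern of \<open>X\<close>, so that \<open>X\<close> satisfies the
    constraints \<open>orth\<close>. At \<open>None\<close> the sign is \<open>1\<close>, which
    makes all heights nonnegative.\<close>
  define s :: "'v option \<Rightarrow> int" where "s w = (if X w \<ge> 0 then 1 else -1)" for w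
  define hom :: "('v \<Rightarrow> int) \<times> int \<Rightarrow> 'v option \<Rightarrow> int" where
    "hom c w = (case w of None \<Rightarrow> - snd c | Some v \<Rightarrow> fst c v)" for c w
  define orth :: "'v option \<Rightarrow> 'v option \<Rightarrow> int" where "orth w w' = (if w' = w then - s w else 0)" for w w'
  define As where "As = hom ` Cs \<union> orth ` W"
  have finW: "finite W" using fin by (simp add: W_def)
  have cW: "card W = card V + 1" using fin by (simp add: W_def card_insert_if card_image)
  have finA: "finite As" using fin finW by (simp add: As_def)
  have cA: "card As \<le> 2 * N + 1"
    unfolding As_def using card_Un_le[of "hom ` Cs" "orth ` W"] card_image_le[OF fin(2), of hom]
      card_image_le[OF finW, of orth] N cW by linarith
  have linhom: "lin W (hom c) y = lin V (fst c) (\<lambda>v. y (Some v)) - real_of_int (snd c) * y None" for c y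
    using fin by (simp add: lin_def W_def hom_def sum.reindex)
  have linorth: "lin W (orth w) y = - real_of_int (s w) * y w" if "w \<in> W" for w y
    using that finW by (simp add: lin_def orth_def if_distrib[of real_of_int] if_distrib[of "\<lambda>x. x * _"] cong: if_cong)
  have ex: "\<exists>k R l. k \<le> card {a\<in>As. lin W a X \<noteq> 0} \<and>
    (\<forall>i<k. 0 \<le> l i \<and> (\<forall>a\<in>As. lin W a (\<lambda>v. real_of_int (R i v)) \<le> 0) \<and> (\<forall>v. \<bar>R i v\<bar> \<le> 2 ^ qp_exp (5 * N + 5) \<beta>)) \<and>
    (\<forall>v\<in>W. X v = (\<Sum>i<k. l i * real_of_int (R i v)))"
  proof (rule cone_decomposition[OF finW finA, where s = s])
    \<comment> \<open>With \<open>N + 1\<close> unknowns and \<open>2 * N + 1\<close> constraints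
      the left side is at most \<open>(N + 1) + 2 * (2 * N + 1) + 2\<close>.\<close>
    show "card W + 2 * card As + 2 \<le> 5 * N + 5" using cW cA N by linarith
    show "\<bar>a w\<bar> \<le> 2 ^ \<beta>" if "a \<in> As" "w \<in> W" for a w
      using that C by (auto simp: As_def W_def hom_def orth_def s_def)
    show "\<bar>s w\<bar> = 1" for w by (simp add: s_def)
    show "0 \<le> real_of_int (s w) * y w" if "\<And>a. a \<in> As \<Longrightarrow> lin W a y \<le> 0" "w \<in> W" for y w
      using that(1)[of "orth w"] that(2) linorth[OF that(2), of y] by (simp add: As_def)
    show "lin W a X \<le> 0" if "a \<in> As" for a
      using that unfolding As_def
    proof
      assume "a \<in> hom ` Cs"
      then show ?thesis using x by (auto simp: linhom X_def feas_def)
    next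
      assume "a \<in> orth ` W"
      then show ?thesis by (auto simp: linorth s_def)
    qed
  qed
  then obtain k R l where kRl: "k \<le> card {a\<in>As. lin W a X \<noteq> 0} \<and>
    (\<forall>i<k. 0 \<le> l i \<and> (\<forall>a\<in>As. lin W a (\<lambda>v. real_of_int (R i v)) \<le> 0) \<and> (\<forall>v. \<bar>R i v\<bar> \<le> 2 ^ qp_exp (5 * N + 5) \<beta>)) \<and>
    (\<forall>v\<in>W. X v = (\<Sum>i<k. l i * real_of_int (R i v)))"
    by blast
  have k: "k \<le> card {a\<in>As. lin W a X \<noteq> 0}"
    and l0: "\<And>i. i < k \<Longrightarrow> 0 \<le> l i" and RA: "\<And>i a. i < k \<Longrightarrow> a \<in> As \<Longrightarrow> lin W a (\<lambda>v. real_of_int (R i v)) \<le> 0"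
    and Rb: "\<And>i w. i < k \<Longrightarrow> \<bar>R i w\<bar> \<le> 2 ^ e N \<beta>"
    and X: "\<And>w. w \<in> W \<Longrightarrow> X w = (\<Sum>i<k. l i * real_of_int (R i w))"
    using kRl unfolding e_def by blast+
  have "card {a\<in>As. lin W a X \<noteq> 0} \<le> card As" using finA by (intro card_mono) auto
  then have kN: "k \<le> 2 * N + 1" using k cA by linarith
  have height: "0 \<le> R i None" if "i < k" for i
  proof -
    have "orth None \<in> As" "None \<in> W" by (auto simp: As_def W_def)
    then show ?thesis
      using RA[OF that, of "orth None"] linorth[of None "\<lambda>w. real_of_int (R i w)"] by (simp add: s_def X_def)
  qed
  have RC: "lin V (fst c) (\<lambda>v. real_of_int (R i (Some v))) \<le> real_of_int (snd c) * real_of_int (R i None)"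
    if "i < k" "c \<in> Cs" for i c
    using RA[OF that(1), of "hom c"] that by (simp add: As_def linhom)
  have one: "(\<Sum>i<k. l i * real_of_int (R i None)) = 1"
    using X[of None] by (simp add: W_def X_def)
  define I where "I = {i. i < k \<and> R i None = 0}"
  \<comment> \<open>On generators of height \<open>0\<close> the integer part is split off and the
    fractional part stays in \<open>z\<close>. Thus \<open>x\<close> and \<open>z\<close> differ by
    an integral vector on \<open>V\<close>.\<close>
  define K where "K i = nat \<lfloor>l i\<rfloor>" for i
  define \<theta> where "\<theta> i = (if i \<in> I then l i - real (K i) else l i)" for i
  define z where "z v = (\<Sum>i<k. \<theta> i * real_of_int (R i (Some v)))" for v
  have finI: "finite I" and IK: "I \<subseteq> {..<k}" by (auto simp: I_def)
  have \<theta>01: "0 \<le> \<theta> i \<and> \<theta> i \<le> 1" if i: "i < k" for i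
  proof (cases "i \<in> I")
    case True
    then show ?thesis using l0[OF i] by (simp add: \<theta>_def K_def) linarith
  next
    case False
    then have "1 \<le> R i None" using height[OF i] i by (simp add: I_def)
    then have "l i \<le> l i * real_of_int (R i None)"
      using l0[OF i] by (simp add: mult_le_cancel_left1)
    also have "\<dots> \<le> (\<Sum>i<k. l i * real_of_int (R i None))"
      using i l0 height by (intro member_le_sum) auto
    finally show ?thesis using one l0[OF i] False by (simp add: \<theta>_def)
  qed
  show thesis
  proof (rule that[of I "\<lambda>i v. R i (Some v)" z K])
    show "finite I" by fact
    show "card I \<le> 2 * N + 1" using card_mono[OF _ IK] kN by simp
    show "recession V Cs (\<lambda>v. R i (Some v))" if "i \<in> I" for i
      using RC[of i] that by (auto simp: recession_def I_def)
    show "\<bar>R i (Some v)\<bar> \<le> 2 ^ e N \<beta>" if "i \<in> I" for i v using Rb that by (simp add: I_def)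
    show "z \<in> feas V Cs" unfolding feas_def mem_Collect_eq
    proof
      fix c assume c: "c \<in> Cs"
      have "lin V (fst c) z = (\<Sum>i<k. \<theta> i * lin V (fst c) (\<lambda>v. real_of_int (R i (Some v))))"
        by (simp add: z_def[abs_def] lin_sum lin_scale)
      also have "\<dots> \<le> (\<Sum>i<k. \<theta> i * (real_of_int (snd c) * real_of_int (R i None)))"
        using RC[OF _ c] \<theta>01 by (intro sum_mono mult_left_mono) auto
      \<comment> \<open>The coefficients \<open>\<theta>\<close> and \<open>l\<close> differ only on
        generators of height \<open>0\<close>, whose terms vanish here.\<close>
      also have "\<dots> = (\<Sum>i<k. l i * (real_of_int (snd c) * real_of_int (R i None)))"
        by (intro sum.cong) (auto simp: \<theta>_def I_def)
      also have "\<dots> = real_of_int (snd c) * (\<Sum>i<k. l i * real_of_int (R i None))"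
        by (simp add: sum_distrib_left mult_ac)
      finally show "lin V (fst c) z \<le> real_of_int (snd c)" by (simp add: one)
    qed
    show "\<bar>z v\<bar> \<le> 2 ^ (2 * N + 1 + e N \<beta>)" for v
    proof -
      have "\<bar>z v\<bar> \<le> (\<Sum>i<k. \<bar>\<theta> i * real_of_int (R i (Some v))\<bar>)"
        unfolding z_def by (rule sum_abs)
      also have "\<dots> \<le> (\<Sum>i<k. 1 * 2 ^ e N \<beta>)"
      proof (rule sum_mono)
        fix i assume "i \<in> {..<k}"
        then have "i < k" by simp
        have "real_of_int \<bar>R i (Some v)\<bar> \<le> 2 ^ e N \<beta>"
          using Rb[OF \<open>i < k\<close>, of "Some v"] by (metis of_int_le_iff of_int_numeral of_int_power)
        then show "\<bar>\<theta> i * real_of_int (R i (Some v))\<bar> \<le> 1 * 2 ^ e N \<beta>"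
          unfolding abs_mult using \<theta>01[OF \<open>i < k\<close>] by (intro mult_mono) auto
      qed
      also have "\<dots> = real k * 2 ^ e N \<beta>" by simp
      also have "\<dots> \<le> 2 ^ (2 * N + 1) * 2 ^ e N \<beta>"
      proof (rule mult_right_mono)
        have "k \<le> 2 ^ (2 * N + 1)" using kN less_exp[of "2 * N + 1"] by linarith
        then show "real k \<le> 2 ^ (2 * N + 1)" by (metis of_nat_le_iff of_nat_numeral of_nat_power)
      qed simp
      finally show ?thesis by (simp add: power_add)
    qed
    show "x v = z v + (\<Sum>i\<in>I. real (K i) * real_of_int (R i (Some v)))" if "v \<in> V" for v
    proof -
      have "x v = (\<Sum>i<k. l i * real_of_int (R i (Some v)))"
        using X[of "Some v"] that by (simp add: X_def W_def)
      also have "\<dots> = z v + (\<Sum>i<k. (if i \<in> I then real (K i) * real_of_int (R i (Some v)) else 0))"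
        unfolding z_def sum.distrib[symmetric]
        by (intro sum.cong) (auto simp: \<theta>_def algebra_simps)
      also have "(\<Sum>i<k. (if i \<in> I then real (K i) * real_of_int (R i (Some v)) else 0))
          = (\<Sum>i\<in>I. real (K i) * real_of_int (R i (Some v)))"
        using IK by (simp add: sum.inter_restrict[symmetric] Int_absorb1)
      finally show ?thesis .
    qed
  qed
qed

section \<open>Size bounds and descent along rays\<close>

lemma abs_of_int_le_power: "\<bar>i\<bar> \<le> 2 ^ k \<Longrightarrow> \<bar>real_of_int i\<bar> \<le> 2 ^ k"
  by (metis of_int_abs of_int_le_iff of_int_numeral of_int_power)

lemma of_nat_le_power2: "k \<le> N \<Longrightarrow> real k \<le> 2 ^ N"
  by (metis less_exp less_imp_le of_nat_le_iff of_nat_numeral of_nat_power order_trans)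

lemma abs_sum_le_power:
  fixes f :: "'a \<Rightarrow> real"
  assumes "card A \<le> N" "\<And>a. a \<in> A \<Longrightarrow> \<bar>f a\<bar> \<le> 2 ^ k"
  shows "\<bar>sum f A\<bar> \<le> 2 ^ (N + k)"
proof -
  have "\<bar>sum f A\<bar> \<le> (\<Sum>a\<in>A. \<bar>f a\<bar>)" by (rule sum_abs)
  also have "\<dots> \<le> real (card A) * 2 ^ k" using assms(2) by (intro sum_bounded_above) auto
  also have "\<dots> \<le> 2 ^ N * 2 ^ k" using of_nat_le_power2[OF assms(1)] by (intro mult_right_mono) auto
  finally show ?thesis by (simp add: power_add)
qed

lemma abs_mult_le_power:
  fixes x y :: "'a :: linordered_idom"
  shows "\<bar>x\<bar> \<le> 2 ^ i \<Longrightarrow> \<bar>y\<bar> \<le> 2 ^ j \<Longrightarrow> \<bar>x * y\<bar> \<le> 2 ^ (i + j)"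
  unfolding abs_mult power_add by (intro mult_mono) auto

lemma abs_lin_le:
  assumes "card V \<le> N" "\<And>v. v \<in> V \<Longrightarrow> \<bar>a v\<bar> \<le> 2 ^ \<alpha>" "\<And>v. v \<in> V \<Longrightarrow> \<bar>x v\<bar> \<le> 2 ^ \<xi>"
  shows "\<bar>lin V a x\<bar> \<le> 2 ^ (N + (\<alpha> + \<xi>))"
  unfolding lin_def using assms by (intro abs_sum_le_power abs_mult_le_power abs_of_int_le_power) auto

lemma abs_bil_le:
  assumes "card V \<le> N" "\<And>u v. u \<in> V \<Longrightarrow> v \<in> V \<Longrightarrow> \<bar>Q u v\<bar> \<le> 2 ^ \<alpha>"
    "\<And>v. v \<in> V \<Longrightarrow> \<bar>x v\<bar> \<le> 2 ^ \<xi>" "\<And>v. v \<in> V \<Longrightarrow> \<bar>y v\<bar> \<le> 2 ^ \<eta>"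
  shows "\<bar>bil V Q x y\<bar> \<le> 2 ^ (N + (N + (\<alpha> + \<xi> + \<eta>)))"
  unfolding bil_def using assms by (intro abs_sum_le_power abs_mult_le_power abs_of_int_le_power) auto

lemma power2_mono: "i \<le> j \<Longrightarrow> (2::real) ^ i \<le> 2 ^ j"
  by (rule power_increasing) auto

lemma abs_quad_le:
  assumes N: "card V \<le> N" and Q: "\<And>u v. u \<in> V \<Longrightarrow> v \<in> V \<Longrightarrow> \<bar>Q u v\<bar> \<le> 2 ^ \<alpha>"
    and g: "\<And>v. v \<in> V \<Longrightarrow> \<bar>g v\<bar> \<le> 2 ^ \<alpha>" and d: "\<bar>d\<bar> \<le> 2 ^ \<alpha>"
    and x: "\<And>v. v \<in> V \<Longrightarrow> \<bar>x v\<bar> \<le> 2 ^ \<xi>"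
  shows "\<bar>quad V Q g x + real_of_int d\<bar> \<le> 2 ^ (2 * N + \<alpha> + 2 * \<xi> + 2)"
proof -
  let ?k = "2 * N + \<alpha> + 2 * \<xi>"
  have "\<bar>bil V Q x x\<bar> \<le> 2 ^ ?k"
    by (rule order_trans[OF abs_bil_le[of V N Q \<alpha> x \<xi> x \<xi>]]) (use N Q x in \<open>auto intro!: power2_mono\<close>)
  moreover have "\<bar>lin V g x\<bar> \<le> 2 ^ ?k"
    by (rule order_trans[OF abs_lin_le[of V N g \<alpha> x \<xi>]]) (use N g x in \<open>auto intro!: power2_mono\<close>)
  moreover have "\<bar>real_of_int d\<bar> \<le> 2 ^ ?k"
    using abs_of_int_le_power[OF d] by (rule order_trans) (auto intro!: power2_mono)
  ultimately have "\<bar>quad V Q g x + real_of_int d\<bar> \<le> 4 * 2 ^ ?k"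
    unfolding quad_def by linarith
  then show ?thesis by (simp add: power_add)
qed

lemma abs_dquad_le:
  assumes N: "card V \<le> N" and Q: "\<And>u v. u \<in> V \<Longrightarrow> v \<in> V \<Longrightarrow> \<bar>Q u v\<bar> \<le> 2 ^ \<alpha>"
    and g: "\<And>v. v \<in> V \<Longrightarrow> \<bar>g v\<bar> \<le> 2 ^ \<alpha>"
    and x: "\<And>v. v \<in> V \<Longrightarrow> \<bar>x v\<bar> \<le> 2 ^ \<xi>" and y: "\<And>v. v \<in> V \<Longrightarrow> \<bar>y v\<bar> \<le> 2 ^ \<eta>"
  shows "\<bar>dquad V Q g x y\<bar> \<le> 2 ^ (2 * N + \<alpha> + \<xi> + \<eta> + 2)"
proof -
  let ?k = "2 * N + \<alpha> + \<xi> + \<eta>"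
  have "\<bar>bil V Q x y\<bar> \<le> 2 ^ ?k"
    by (rule order_trans[OF abs_bil_le[of V N Q \<alpha> x \<xi> y \<eta>]]) (use N Q x y in \<open>auto intro!: power2_mono\<close>)
  moreover have "\<bar>bil V Q y x\<bar> \<le> 2 ^ ?k"
    by (rule order_trans[OF abs_bil_le[of V N Q \<alpha> y \<eta> x \<xi>]]) (use N Q x y in \<open>auto intro!: power2_mono\<close>)
  moreover have "\<bar>lin V g y\<bar> \<le> 2 ^ ?k"
    by (rule order_trans[OF abs_lin_le[of V N g \<alpha> y \<eta>]]) (use N g y in \<open>auto intro!: power2_mono\<close>)
  ultimately have "\<bar>dquad V Q g x y\<bar> \<le> 4 * 2 ^ ?k"
    unfolding dquad_def by linarith
  then show ?thesis by (simp add: power_add)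
qed

text \<open>Freezing the coordinates in \<open>P\<close> at their integer values in \<open>x\<close>
  removes integrality from the problem, and the box makes the fibre a polytope. Frozen values and
  box sides become right-hand sides, hence \<open>\<xi> \<le> \<beta>\<close>. The count
  \<open>6 * N\<close> comprises the variables, \<open>Cs\<close>, and two constraints for each
  element of \<open>P\<close> and of \<open>V\<close>.\<close>

lemma fibre_small_minimizer:
  fixes V :: "'v set"
  assumes fin: "finite V" "finite Cs" and N: "card V \<le> N" "card Cs \<le> N" and P: "P \<subseteq> V"
    and Q: "\<And>u v. u \<in> V \<Longrightarrow> v \<in> V \<Longrightarrow> \<bar>Q u v\<bar> \<le> 2 ^ \<beta>"
    and g: "\<And>v. v \<in> V \<Longrightarrow> \<bar>g v\<bar> \<le> 2 ^ \<beta>"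
    and C: "\<And>c v. c \<in> Cs \<Longrightarrow> v \<in> V \<Longrightarrow> \<bar>fst c v\<bar> \<le> 2 ^ \<beta>" "\<And>c. c \<in> Cs \<Longrightarrow> \<bar>snd c\<bar> \<le> 2 ^ \<beta>"
    and x: "x \<in> feas V Cs" "\<And>v. v \<in> P \<Longrightarrow> x v \<in> \<int>"
    and box: "\<And>v. v \<in> V \<Longrightarrow> \<bar>x v\<bar> \<le> 2 ^ \<xi>" "\<xi> \<le> \<beta>"
  obtains t :: int and n :: "'v \<Rightarrow> int" where "t \<ge> 1" "t \<le> 2 ^ qp_exp (6 * N) \<beta>"
    "\<And>v. \<bar>n v\<bar> \<le> 2 ^ qp_exp (6 * N) \<beta>" "(\<lambda>v. n v / t) \<in> feas V Cs"
    "\<And>v. v \<in> P \<Longrightarrow> n v / t \<in> \<int>" "\<And>v. v \<in> V \<Longrightarrow> \<bar>n v / t\<bar> \<le> 2 ^ \<xi>"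
    "quad V Q g (\<lambda>v. n v / t) \<le> quad V Q g x"
proof -
  define e :: "'v \<Rightarrow> 'v \<Rightarrow> int" where "e v w = (if w = v then 1 else 0)" for v w
  define y where "y v = \<lfloor>x v\<rfloor>" for v
  have xy: "x v = real_of_int (y v)" if "v \<in> P" for v
    using x(2)[OF that] by (simp add: y_def)
  have line: "lin V (e v) w = w v" if "v \<in> V" for v w
    using that fin by (simp add: lin_def e_def if_distrib[of real_of_int] if_distrib[of "\<lambda>x. x * _"] cong: if_cong)
  define F where "F = Cs \<union> ((\<lambda>v. (e v, y v)) ` P \<union> ((\<lambda>v. (\<lambda>w. - e v w, - y v)) ` P \<union>
     ((\<lambda>v. (e v, 2 ^ \<xi>)) ` V \<union> (\<lambda>v. (\<lambda>w. - e v w, 2 ^ \<xi>)) ` V)))"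
  have finP: "finite P" using P fin finite_subset by blast
  have cP: "card P \<le> N" using card_mono[OF fin(1) P] N by simp
  have un: "card (A \<union> B) \<le> a + b" if "card A \<le> a" "card B \<le> b" for A B :: "(('v \<Rightarrow> int) \<times> int) set" and a b
    using card_Un_le[of A B] that by linarith
  have im: "card (f ` A) \<le> N" if "finite A" "card A \<le> N" for f :: "'v \<Rightarrow> ('v \<Rightarrow> int) \<times> int" and A
    using card_image_le[OF that(1), of f] that by linarith
  have "card F \<le> N + (N + (N + (N + N)))"
    unfolding F_def using finP fin cP N by (intro un im) auto
  then have cF: "card V + card F \<le> 6 * N" using N by simp
  have finF: "finite F" using fin finP by (simp add: F_def)
  have feasF: "w \<in> feas V F \<longleftrightarrow> w \<in> feas V Cs \<and> (\<forall>v\<in>P. w v = real_of_int (y v)) \<and> (\<forall>v\<in>V. \<bar>w v\<bar> \<le> 2 ^ \<xi>)" for w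
  proof -
    have lineP: "lin V (e v) w = w v" if "v \<in> P" for v using line P that by blast
    have "(\<forall>v\<in>P. lin V (e v) w \<le> y v) \<and> (\<forall>v\<in>P. lin V (\<lambda>w. - e v w) w \<le> real_of_int (- y v))
        \<longleftrightarrow> (\<forall>v\<in>P. w v = real_of_int (y v))"
      by (auto simp: lin_minus lineP intro: antisym)
    moreover have "(\<forall>v\<in>V. lin V (e v) w \<le> real_of_int (2 ^ \<xi>)) \<and>
        (\<forall>v\<in>V. lin V (\<lambda>w. - e v w) w \<le> real_of_int (2 ^ \<xi>)) \<longleftrightarrow> (\<forall>v\<in>V. \<bar>w v\<bar> \<le> 2 ^ \<xi>)"
      by (auto simp: lin_minus line abs_le_iff)
    ultimately show ?thesis
      unfolding feas_def F_def mem_Collect_eq ball_Un ball_simps fst_conv snd_conv by blast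
  qed
  have e1: "\<bar>e v w\<bar> \<le> 2 ^ \<beta>" for v w by (simp add: e_def)
  have y1: "\<bar>y v\<bar> \<le> 2 ^ \<beta>" if "v \<in> P" for v
  proof -
    have "real_of_int \<bar>y v\<bar> \<le> 2 ^ \<xi>" using box(1)[of v] xy[OF that] that P by auto
    also have "\<dots> \<le> 2 ^ \<beta>" by (rule power2_mono[OF box(2)])
    finally show ?thesis by (metis of_int_le_iff of_int_numeral of_int_power)
  qed
  have \<xi>1: "(2::int) ^ \<xi> \<le> 2 ^ \<beta>" by (rule power_increasing[OF box(2)]) simp
  obtain t :: int and n :: "'v \<Rightarrow> int" where tn: "t \<ge> 1" "t \<le> 2 ^ qp_exp (6 * N) \<beta>"
    "\<And>v. \<bar>n v\<bar> \<le> 2 ^ qp_exp (6 * N) \<beta>" "(\<lambda>v. n v / t) \<in> feas V F"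
    "\<And>w. w \<in> feas V F \<Longrightarrow> quad V Q g (\<lambda>v. n v / t) \<le> quad V Q g w"
  proof (rule qp_small_minimizer[OF fin(1) finF cF, where Q = Q and g = g and \<beta> = \<beta> and \<gamma> = "2 ^ \<xi>"])
    show "\<bar>fst c v\<bar> \<le> 2 ^ \<beta>" if "c \<in> F" "v \<in> V" for c v
      using that C(1)[of c v] e1 unfolding F_def by auto
    show "\<bar>snd c\<bar> \<le> 2 ^ \<beta>" if "c \<in> F" for c
      using that C(2)[of c] y1 \<xi>1 unfolding F_def by auto
    show "x \<in> feas V F" using x xy box by (simp add: feasF)
    show "\<bar>w v\<bar> \<le> 2 ^ \<xi>" if "w \<in> feas V F" "v \<in> V" for w v using that by (simp add: feasF)
  qed (use Q g in auto)
  show thesis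
  proof (rule that[OF tn(1-3)])
    show "(\<lambda>v. n v / t) \<in> feas V Cs" using tn(4) by (simp add: feasF)
    show "n v / t \<in> \<int>" if "v \<in> P" for v using tn(4) that by (simp add: feasF)
    show "\<bar>n v / t\<bar> \<le> 2 ^ \<xi>" if "v \<in> V" for v using tn(4) that unfolding feasF by blast
    show "quad V Q g (\<lambda>v. n v / t) \<le> quad V Q g x"
      using x xy box by (intro tn(5)) (simp add: feasF)
  qed
qed

text \<open>One denominator is shared by all coordinates, so adding an integral multiple of a ray
  changes the numerators only.\<close>

definition small_feasible ::
  "'v set \<Rightarrow> 'v set \<Rightarrow> (('v \<Rightarrow> int) \<times> int) set \<Rightarrow> ('v \<Rightarrow> 'v \<Rightarrow> int) \<Rightarrow> ('v \<Rightarrow> int) \<Rightarrow> int \<Rightarrow> nat \<Rightarrow> bool" where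
  "small_feasible V P Cs H c d e \<longleftrightarrow> (\<exists>(t::int) (n::'v \<Rightarrow> int). 1 \<le> t \<and> t \<le> (2::int) ^ e \<and> (\<forall>v\<in>V. \<bar>n v\<bar> \<le> (2::int) ^ e) \<and>
     (\<lambda>v. n v / t) \<in> feas V Cs \<and> (\<forall>v\<in>P. n v / t \<in> \<int>) \<and> quad V H c (\<lambda>v. n v / t) + d \<le> 0)"

lemma small_feasible_mono:
  assumes "small_feasible V P Cs H c d e" "e \<le> e'"
  shows "small_feasible V P Cs H c d e'"
proof -
  have "(2::int) ^ e \<le> 2 ^ e'" using assms(2) by (rule power_increasing) simp
  then show ?thesis using assms(1) unfolding small_feasible_def by (meson order_trans)
qed

text \<open>Here \<open>e\<close> measures the rational starting point. It enters twice: the step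
  along the ray must beat the denominator of the starting point, and the step is multiplied by that
  denominator again in the numerators.\<close>

definition escape_exp :: "nat \<Rightarrow> nat \<Rightarrow> nat \<Rightarrow> nat \<Rightarrow> nat" where
  "escape_exp N \<beta> \<zeta> \<epsilon> = (let e = qp_exp (6 * N) (N + 1 + \<beta> + \<epsilon> + \<zeta>) in
     2 * e + 2 * N + \<beta> + 2 * \<zeta> + 2 * \<epsilon> + 5)"

text \<open>Since \<open>z\<close> is only real, it is first replaced by a rational point of its
  fibre that minimises the slope along \<open>r\<close>, so that descent is not lost. Integrality
  then quantifies the descent: negative curvature is at most \<open>-1\<close>, and a negative slope
  at a point with denominator \<open>t\<close> is at most \<open>-1/t\<close>. A step
  \<open>2 ^ \<tau>\<close> outweighs the initial value.\<close>

lemma escape_small_feasible: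
  fixes V :: "'v set"
  assumes fin: "finite V" "finite Cs" and N: "card V \<le> N" "card Cs \<le> N" and P: "P \<subseteq> V"
    and H: "\<And>u v. u \<in> V \<Longrightarrow> v \<in> V \<Longrightarrow> \<bar>H u v\<bar> \<le> 2 ^ \<beta>"
    and c: "\<And>v. v \<in> V \<Longrightarrow> \<bar>c v\<bar> \<le> 2 ^ \<beta>" and d: "\<bar>d\<bar> \<le> 2 ^ \<beta>"
    and C: "\<And>c v. c \<in> Cs \<Longrightarrow> v \<in> V \<Longrightarrow> \<bar>fst c v\<bar> \<le> 2 ^ \<beta>" "\<And>c. c \<in> Cs \<Longrightarrow> \<bar>snd c\<bar> \<le> 2 ^ \<beta>"
    and z: "z \<in> feas V Cs" "\<And>v. v \<in> P \<Longrightarrow> z v \<in> \<int>" "\<And>v. v \<in> V \<Longrightarrow> \<bar>z v\<bar> \<le> 2 ^ \<zeta>"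
    and r: "recession V Cs r" "\<And>v. v \<in> V \<Longrightarrow> \<bar>r v\<bar> \<le> 2 ^ \<epsilon>"
    and descent: "bil V H r r < 0 \<or> bil V H r r = 0 \<and> dquad V H c z r < 0"
  shows "small_feasible V P Cs H c d (escape_exp N \<beta> \<zeta> \<epsilon>)"
proof -
  \<comment> \<open>The coefficients of the slope functional \<open>g\<close> need
    \<open>N + (\<beta> + 1) + \<epsilon>\<close> bits; \<open>\<zeta>\<close> is added to admit the
    box as data.\<close>
  define \<beta>' where "\<beta>' = N + 1 + \<beta> + \<epsilon> + \<zeta>"
  define e where "e = qp_exp (6 * N) \<beta>'"
  define g where "g v = (\<Sum>u\<in>V. (H u v + H v u) * r u)" for v
  have g_lin: "dquad V H c y (\<lambda>v. real_of_int (r v)) = lin V g y + lin V c (\<lambda>v. real_of_int (r v))" for y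
  proof -
    have "bil V H y (\<lambda>v. real_of_int (r v)) = (\<Sum>v\<in>V. (\<Sum>u\<in>V. real_of_int (H v u) * r u) * y v)"
      by (simp add: bil_def sum_distrib_right sum_distrib_left mult_ac)
    moreover have "bil V H (\<lambda>v. real_of_int (r v)) y = (\<Sum>v\<in>V. (\<Sum>u\<in>V. real_of_int (H u v) * r u) * y v)"
      unfolding bil_def by (subst sum.swap) (simp add: sum_distrib_right sum_distrib_left mult_ac)
    ultimately show ?thesis
      by (simp add: dquad_def lin_def g_def sum.distrib distrib_right)
  qed
  have mono: "i \<le> 2 ^ \<beta> \<Longrightarrow> i \<le> (2::int) ^ \<beta>'" for i
    by (rule order_trans[OF _ power_increasing]) (auto simp: \<beta>'_def)
  have g: "\<bar>g v\<bar> \<le> 2 ^ \<beta>'" if v: "v \<in> V" for v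
  proof -
    have "\<bar>real_of_int (g v)\<bar> = \<bar>\<Sum>u\<in>V. real_of_int ((H u v + H v u) * r u)\<bar>" by (simp add: g_def)
    also have "\<dots> \<le> 2 ^ (N + ((\<beta> + 1) + \<epsilon>))"
    proof (rule abs_sum_le_power[OF N(1)])
      fix u assume u: "u \<in> V"
      have "\<bar>H u v + H v u\<bar> \<le> 2 ^ \<beta> + 2 ^ \<beta>" using H[OF u v] H[OF v u] by linarith
      then have "\<bar>H u v + H v u\<bar> \<le> 2 ^ (\<beta> + 1)" by simp
      then show "\<bar>real_of_int ((H u v + H v u) * r u)\<bar> \<le> 2 ^ ((\<beta> + 1) + \<epsilon>)"
        using r(2)[OF u] by (intro abs_of_int_le_power abs_mult_le_power)
    qed
    also have "\<dots> \<le> 2 ^ \<beta>'" by (rule power2_mono) (simp add: \<beta>'_def)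
    finally show ?thesis by (metis of_int_abs of_int_le_iff of_int_numeral of_int_power)
  qed
  obtain t :: int and n :: "'v \<Rightarrow> int" where tn: "t \<ge> 1" "t \<le> 2 ^ e"
    "\<And>v. \<bar>n v\<bar> \<le> 2 ^ e" "(\<lambda>v. n v / t) \<in> feas V Cs"
    "\<And>v. v \<in> P \<Longrightarrow> n v / t \<in> \<int>" "\<And>v. v \<in> V \<Longrightarrow> \<bar>n v / t\<bar> \<le> 2 ^ \<zeta>"
    "quad V (\<lambda>_ _. 0) g (\<lambda>v. n v / t) \<le> quad V (\<lambda>_ _. 0) g z"
    unfolding e_def
  proof (rule fibre_small_minimizer[OF fin N P, where Q = "\<lambda>_ _. 0" and g = g and \<beta> = \<beta>' and x = z and \<xi> = \<zeta>])
    show "\<bar>fst c v\<bar> \<le> 2 ^ \<beta>'" if "c \<in> Cs" "v \<in> V" for c v using mono C that by blast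
    show "\<bar>snd c\<bar> \<le> 2 ^ \<beta>'" if "c \<in> Cs" for c using mono C that by blast
    show "\<zeta> \<le> \<beta>'" by (simp add: \<beta>'_def)
  qed (use z g in auto)
  define y where "y v = n v / t" for v
  define \<rho> where "\<rho> v = real_of_int (r v)" for v
  have yz: "dquad V H c y \<rho> \<le> dquad V H c z \<rho>"
    using tn(7) unfolding g_lin[folded \<rho>_def[abs_def]] y_def[abs_def] by (simp add: quad_def bil_def)
  define q where "q = quad V H c y + d"
  define G where "G = dquad V H c y \<rho>"
  define h where "h = bil V H \<rho> \<rho>"
  \<comment> \<open>Equal to \<open>e + k + 2\<close> for the \<open>k\<close> below, enough for
    both requirements on \<open>T\<close>: beating \<open>2 ^ k\<close> times the denominator
    \<open>t\<close>, and beating \<open>2 ^ k + 2 ^ k\<close>.\<close>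
  define \<tau> where "\<tau> = e + 2 * N + \<beta> + 2 * \<zeta> + \<epsilon> + 4"
  define T :: real where "T = 2 ^ \<tau>"
  have yb: "\<bar>y v\<bar> \<le> 2 ^ \<zeta>" if "v \<in> V" for v using tn(6)[OF that] by (simp add: y_def)
  have \<rho>b: "\<bar>\<rho> v\<bar> \<le> 2 ^ \<epsilon>" if "v \<in> V" for v using abs_of_int_le_power[OF r(2)[OF that]] by (simp add: \<rho>_def)
  define k where "k = 2 * N + \<beta> + 2 * \<zeta> + \<epsilon> + 2"
  have qb: "\<bar>q\<bar> \<le> 2 ^ k"
    unfolding q_def by (rule order_trans[OF abs_quad_le[of V N H \<beta> c d y \<zeta>]])
      (use N H c d yb in \<open>auto simp: k_def intro!: power2_mono\<close>)
  have Gb: "\<bar>G\<bar> \<le> 2 ^ k"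
    unfolding G_def by (rule order_trans[OF abs_dquad_le[of V N H \<beta> c y \<zeta> \<rho> \<epsilon>]])
      (use N H c yb \<rho>b in \<open>auto simp: k_def intro!: power2_mono\<close>)
  have T1: "T \<ge> 1" by (simp add: T_def)
  have Tk: "T \<ge> 2 ^ k * real_of_int t"
  proof -
    have "2 ^ k * real_of_int t \<le> 2 ^ k * 2 ^ e"
      using tn(2) by (intro mult_left_mono) (metis of_int_le_iff of_int_numeral of_int_power, simp)
    also have "\<dots> \<le> T" unfolding T_def power_add[symmetric] by (rule power2_mono) (simp add: \<tau>_def k_def)
    finally show ?thesis .
  qed
  have Tk2: "T \<ge> 2 ^ k + 2 ^ k"
  proof -
    have "(2::real) ^ k + 2 ^ k = 2 ^ (k + 1)" by simp
    also have "\<dots> \<le> T" unfolding T_def by (rule power2_mono) (simp add: \<tau>_def k_def)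
    finally show ?thesis .
  qed
  \<comment> \<open>With negative curvature the quadratic term is at most \<open>- T * T\<close>,
    while the other two are at most \<open>2 ^ k\<close> and \<open>T * 2 ^ k\<close>. With zero
    curvature the slope alone has to absorb \<open>q\<close>.\<close>
  have neg: "q + T * G + T\<^sup>2 * h \<le> 0"
  proof (cases "h < 0")
    case True
    have h_int: "h = real_of_int (\<Sum>u\<in>V. \<Sum>v\<in>V. H u v * r u * r v)" unfolding h_def \<rho>_def[abs_def] by (rule bil_of_int)
    have "(\<Sum>u\<in>V. \<Sum>v\<in>V. H u v * r u * r v) < 0" using True unfolding h_int by (simp only: of_int_less_0_iff)
    then have "(\<Sum>u\<in>V. \<Sum>v\<in>V. H u v * r u * r v) \<le> -1" by linarith
    then have "h \<le> -1" unfolding h_int by linarith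
    then have "T\<^sup>2 * h \<le> T\<^sup>2 * (-1)" by (intro mult_left_mono) auto
    moreover have "T * G \<le> T * 2 ^ k" using Gb T1 by (intro mult_left_mono) auto
    moreover have "T * (2 ^ k + 2 ^ k) \<le> T * T" using Tk2 T1 by (intro mult_left_mono) auto
    moreover have "1 * 2 ^ k \<le> T * 2 ^ k" using T1 by (intro mult_right_mono) auto
    ultimately show ?thesis using qb unfolding power2_eq_square distrib_left by linarith
  next
    case False
    then have h0: "h = 0" and "dquad V H c z \<rho> < 0"
      using descent unfolding h_def \<rho>_def[abs_def] by auto
    then have G0: "G < 0" using yz by (simp add: G_def)
    \<comment> \<open>Multiplication by the denominator of \<open>y\<close> makes the slope an
      integer, so being negative it is at most \<open>-1\<close>.\<close>
    have "t * G = lin V g (\<lambda>v. t * y v) + t * lin V c \<rho>"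
      unfolding G_def \<rho>_def[abs_def] g_lin lin_scale by (simp add: distrib_left)
    also have "(\<lambda>v. t * y v) = (\<lambda>v. real_of_int (n v))" using tn(1) by (simp add: y_def)
    also have "lin V g (\<lambda>v. real_of_int (n v)) + t * lin V c \<rho>
       = real_of_int ((\<Sum>v\<in>V. g v * n v) + t * (\<Sum>v\<in>V. c v * r v))"
      unfolding \<rho>_def[abs_def] lin_of_int by simp
    finally have tG: "t * G = real_of_int ((\<Sum>v\<in>V. g v * n v) + t * (\<Sum>v\<in>V. c v * r v))" .
    moreover have "t * G < 0" using tn(1) G0 by (simp add: mult_pos_neg)
    ultimately have "(\<Sum>v\<in>V. g v * n v) + t * (\<Sum>v\<in>V. c v * r v) < 0" by (simp only: of_int_less_0_iff)
    then have "(\<Sum>v\<in>V. g v * n v) + t * (\<Sum>v\<in>V. c v * r v) \<le> -1" by linarith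
    then have "t * G \<le> -1" unfolding tG by linarith
    then have "2 ^ k * (t * G) \<le> 2 ^ k * (-1)" by (intro mult_left_mono) auto
    moreover have "T * G \<le> (2 ^ k * t) * G" using Tk G0 by (intro mult_right_mono_neg) auto
    ultimately show ?thesis using qb h0 by (simp add: mult.assoc)
  qed
  define n' where "n' v = n v + t * (2 ^ \<tau> * r v)" for v
  have n': "(\<lambda>v. n' v / t) = (\<lambda>v. y v + T * \<rho> v)"
    using tn(1) by (auto simp: n'_def y_def T_def \<rho>_def field_simps)
  define f where "f = escape_exp N \<beta> \<zeta> \<epsilon>"
  have f: "f = e + \<tau> + \<epsilon> + 1"
    by (simp add: f_def escape_exp_def Let_def e_def \<beta>'_def \<tau>_def)
  show ?thesis
    unfolding small_feasible_def f_def[symmetric]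
  proof (intro exI conjI ballI)
    show "1 \<le> t" by fact
    show "t \<le> 2 ^ f" using tn(2) power_increasing[of e f "2::int"] by (simp add: f)
    show "\<bar>n' v\<bar> \<le> 2 ^ f" if "v \<in> V" for v
    proof -
      have "\<bar>t * (2 ^ \<tau> * r v)\<bar> \<le> 2 ^ (e + (\<tau> + \<epsilon>))"
        using tn(1,2) r(2)[OF that] by (intro abs_mult_le_power) auto
      moreover have "(2::int) ^ e \<le> 2 ^ (e + (\<tau> + \<epsilon>))" by (intro power_increasing) auto
      ultimately have "\<bar>n' v\<bar> \<le> 2 ^ (e + (\<tau> + \<epsilon>)) + 2 ^ (e + (\<tau> + \<epsilon>))"
        using tn(3)[of v] unfolding n'_def by linarith
      then show ?thesis by (simp add: f add.assoc)
    qed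
    show "(\<lambda>v. n' v / t) \<in> feas V Cs"
      unfolding n' feas_def mem_Collect_eq lin_add lin_scale
    proof
      fix c assume c: "c \<in> Cs"
      have "T * lin V (fst c) \<rho> \<le> 0"
        using r(1) c T1 unfolding recession_def \<rho>_def[abs_def] by (intro mult_nonneg_nonpos) auto
      moreover have "lin V (fst c) y \<le> snd c" using tn(4) c by (simp add: feas_def y_def[abs_def])
      ultimately show "lin V (fst c) y + T * lin V (fst c) \<rho> \<le> snd c" by simp
    qed
    show "n' v / t \<in> \<int>" if "v \<in> P" for v
    proof -
      have "n' v / t = n v / t + real_of_int (2 ^ \<tau> * r v)" using fun_cong[OF n', of v] by (simp add: y_def T_def \<rho>_def)
      then show ?thesis using tn(5)[OF that] by (metis Ints_add Ints_of_int)
    qed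
    show "quad V H c (\<lambda>v. n' v / t) + d \<le> 0"
      unfolding n' quad_line using neg by (simp add: q_def G_def h_def)
  qed
qed

text \<open>Homogeneity of degree two clears the denominators and extends minimality from the
  simplex to all nonnegative \<open>\<mu>\<close>. The natural numerators \<open>n\<close> will
  serve as ray multiplicities. The size \<open>2 * N + 2\<close> counts the variables, their sign
  constraints and the two halves of the simplex equation.\<close>

lemma simplex_small_minimizer:
  fixes J :: "'j set"
  assumes J: "finite J" "J \<noteq> {}" "card J \<le> N"
    and M: "\<And>i j. i \<in> J \<Longrightarrow> j \<in> J \<Longrightarrow> \<bar>M i j\<bar> \<le> 2 ^ \<beta>"
  obtains t :: int and n :: "'j \<Rightarrow> nat" where "t \<ge> 1" "t \<le> 2 ^ qp_exp (2 * N + 2) \<beta>"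
    "\<And>i. n i \<le> 2 ^ qp_exp (2 * N + 2) \<beta>" "(\<Sum>i\<in>J. int (n i)) = t"
    "\<And>\<mu>. (\<And>i. i \<in> J \<Longrightarrow> 0 \<le> \<mu> i) \<Longrightarrow> (\<Sum>i\<in>J. \<mu> i)\<^sup>2 * bil J M n n \<le> (real_of_int t)\<^sup>2 * bil J M \<mu> \<mu>"
proof -
  define e :: "'j \<Rightarrow> 'j \<Rightarrow> int" where "e v w = (if w = v then -1 else 0)" for v w
  have line: "lin J (e v) w = - w v" if "v \<in> J" for v w
    using that J by (simp add: lin_def e_def if_distrib[of real_of_int] if_distrib[of "\<lambda>x. x * _"] cong: if_cong)
  define F where "F = (\<lambda>i. (e i, 0::int)) ` J \<union> {(\<lambda>_. 1, 1), (\<lambda>_. -1, -1)}"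
  have finF: "finite F" using J by (simp add: F_def)
  have cF: "card J + card F \<le> 2 * N + 2"
    using card_Un_le[of "(\<lambda>i. (e i, 0::int)) ` J" "{(\<lambda>_. 1, 1), (\<lambda>_. -1, -1)}"]
      card_image_le[OF J(1), of "\<lambda>i. (e i, 0::int)"] J(3)
    by (simp add: F_def card_insert_if split: if_splits)
  have feasF: "w \<in> feas J F \<longleftrightarrow> (\<forall>i\<in>J. 0 \<le> w i) \<and> (\<Sum>i\<in>J. w i) = 1" for w
    unfolding feas_def F_def mem_Collect_eq ball_Un ball_simps
    by (auto simp: line) (auto simp: lin_def sum_negf)
  have norm: "(\<lambda>i. \<mu> i / (\<Sum>i\<in>J. \<mu> i)) \<in> feas J F"
    if "\<And>i. i \<in> J \<Longrightarrow> 0 \<le> \<mu> i" "(\<Sum>i\<in>J. \<mu> i) > 0" for \<mu>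
    using that by (simp add: feasF sum_divide_distrib[symmetric])
  obtain t :: int and n :: "'j \<Rightarrow> int" where tn: "t \<ge> 1" "t \<le> 2 ^ qp_exp (2 * N + 2) \<beta>"
    "\<And>v. \<bar>n v\<bar> \<le> 2 ^ qp_exp (2 * N + 2) \<beta>" "(\<lambda>v. n v / t) \<in> feas J F"
    "\<And>w. w \<in> feas J F \<Longrightarrow> quad J M (\<lambda>_. 0) (\<lambda>v. n v / t) \<le> quad J M (\<lambda>_. 0) w"
  proof (rule qp_small_minimizer[OF J(1) finF cF, where Q = M and g = "\<lambda>_. 0" and \<beta> = \<beta> and \<gamma> = 1])
    show "\<bar>fst c v\<bar> \<le> 2 ^ \<beta>" if "c \<in> F" "v \<in> J" for c v using that by (auto simp: F_def e_def)
    show "\<bar>snd c\<bar> \<le> 2 ^ \<beta>" if "c \<in> F" for c using that by (auto simp: F_def)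
    show "(\<lambda>i. 1 / (\<Sum>i\<in>J. 1)) \<in> feas J F" using J by (intro norm) (auto simp: card_gt_0_iff)
    show "\<bar>w v\<bar> \<le> 1" if "w \<in> feas J F" "v \<in> J" for w v
      using that member_le_sum[OF that(2), of w] J(1) by (auto simp: feasF)
  qed (use M in auto)
  have n0: "0 \<le> n i" if "i \<in> J" for i
    using tn(1,4) that by (auto simp: feasF zero_le_divide_iff)
  have nt: "(\<Sum>i\<in>J. n i) = t"
  proof -
    have "(\<Sum>i\<in>J. real_of_int (n i)) / t = 1" using tn(4) by (simp add: feasF sum_divide_distrib)
    then have "real_of_int (\<Sum>i\<in>J. n i) = t" using tn(1) by (simp add: field_simps)
    then show ?thesis by (simp only: of_int_eq_iff)
  qed
  have nat: "bil J M (\<lambda>i. real (nat (n i))) (\<lambda>i. real (nat (n i))) = bil J M n n"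
    using n0 by (intro bil_cong) auto
  show thesis
  proof (rule that[of t "\<lambda>i. nat (n i)", OF tn(1,2)])
    show "nat (n i) \<le> 2 ^ qp_exp (2 * N + 2) \<beta>" for i
      using tn(3)[of i] by (simp add: nat_le_iff)
    show "(\<Sum>i\<in>J. int (nat (n i))) = t" using n0 nt by simp
    fix \<mu> :: "'j \<Rightarrow> real" assume \<mu>: "\<And>i. i \<in> J \<Longrightarrow> 0 \<le> \<mu> i"
    define \<sigma> where "\<sigma> = (\<Sum>i\<in>J. \<mu> i)"
    show "(\<Sum>i\<in>J. \<mu> i)\<^sup>2 * bil J M (\<lambda>i. real (nat (n i))) (\<lambda>i. real (nat (n i))) \<le> (real_of_int t)\<^sup>2 * bil J M \<mu> \<mu>"
      unfolding nat \<sigma>_def[symmetric]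
    proof (cases "\<sigma> > 0")
      case True
      have "bil J M (\<lambda>v. (1 / t) * n v) (\<lambda>v. (1 / t) * n v) \<le> bil J M (\<lambda>v. (1 / \<sigma>) * \<mu> v) (\<lambda>v. (1 / \<sigma>) * \<mu> v)"
        using tn(5)[OF norm[OF \<mu>]] True by (simp add: quad_def lin_zero_left \<sigma>_def)
      then show "\<sigma>\<^sup>2 * bil J M n n \<le> (real_of_int t)\<^sup>2 * bil J M \<mu> \<mu>"
        unfolding bil_scale_left bil_scale_right using True tn(1)
        by (simp add: field_simps power2_eq_square)
    next
      case False
      then have "\<sigma> = 0" using \<mu> sum_nonneg[of J \<mu>] unfolding \<sigma>_def by fastforce
      then have "\<And>i. i \<in> J \<Longrightarrow> \<mu> i = 0" using \<mu> J sum_nonneg_eq_0_iff[of J \<mu>] unfolding \<sigma>_def by blast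
      then have "bil J M \<mu> \<mu> = 0" by (simp add: bil_def)
      then show "\<sigma>\<^sup>2 * bil J M n n \<le> (real_of_int t)\<^sup>2 * bil J M \<mu> \<mu>" using \<open>\<sigma> = 0\<close> by simp
    qed
  qed
qed

section \<open>Bounding the ray multiplicities\<close>

text \<open>A negative \<open>G\<close> is refuted by the step
  \<open>- G / (\<bar>K\<bar> + 1)\<close>. Steps of one sign suffice at a zero of a copositive
  form, where only nonnegative combinations may be added.\<close>

lemma linear_coeff_nonneg:
  fixes G K :: real
  assumes "\<And>s. s > 0 \<Longrightarrow> 0 \<le> s * G + s\<^sup>2 * K"
  shows "0 \<le> G"
proof (rule ccontr)
  assume G: "\<not> 0 \<le> G"
  define s where "s = - G / (\<bar>K\<bar> + 1)"
  have s: "s > 0" using G unfolding s_def by (intro divide_pos_pos) auto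
  have "s * K \<le> s * \<bar>K\<bar>" using s by (intro mult_left_mono) auto
  also have "\<dots> < s * (\<bar>K\<bar> + 1)" using s by (intro mult_strict_left_mono) auto
  also have "\<dots> = - G" by (simp add: s_def)
  finally have "s * (G + s * K) < 0" using s by (intro mult_pos_neg) auto
  then show False using assms[OF s] by (simp add: power2_eq_square distrib_left)
qed

text \<open>Successive exponents: \<open>e1\<close> for ray entries, \<open>\<zeta>\<close> for base
  points, \<open>e2\<close> for simplex minimisers of the form on the rays, \<open>e3\<close> for
  ray combinations with multiplicities up to \<open>2 ^ e2\<close>, \<open>\<zeta>'\<close> for a
  base point that has absorbed the small multiplicities, \<open>\<sigma>\<close> for the sum of the
  large ones, \<open>\<xi>\<close> for the resulting point. The final sum covers both outcomes,
  escape along a ray and minimisation in a fibre.\<close>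

definition miqp_exp :: "nat \<Rightarrow> nat \<Rightarrow> nat" where
  "miqp_exp N \<beta> =
    (let e1 = qp_exp (5 * N + 5) \<beta>;
         \<zeta> = 2 * N + 1 + e1;
         e2 = qp_exp (2 * (2 * N + 1) + 2) (2 * N + \<beta> + 2 * e1);
         e3 = 2 * N + 1 + e1 + e2;
         \<zeta>' = \<zeta> + e3 + 1;
         \<sigma> = 2 * e2 + 2 * N + \<beta> + 2 * \<zeta>' + e1 + 3;
         \<xi> = \<zeta>' + \<sigma> + e1 + 1
     in escape_exp N \<beta> \<zeta> e3 + qp_exp (6 * N) (\<beta> + \<xi>))"

lemma miqp_small_feasible:
  fixes V :: "'v set"
  assumes fin: "finite V" "finite Cs" and N: "card V \<le> N" "card Cs \<le> N" and P: "P \<subseteq> V"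
    and H: "\<And>u v. u \<in> V \<Longrightarrow> v \<in> V \<Longrightarrow> \<bar>H u v\<bar> \<le> 2 ^ \<beta>"
    and c: "\<And>v. v \<in> V \<Longrightarrow> \<bar>c v\<bar> \<le> 2 ^ \<beta>" and d: "\<bar>d\<bar> \<le> 2 ^ \<beta>"
    and C: "\<And>c v. c \<in> Cs \<Longrightarrow> v \<in> V \<Longrightarrow> \<bar>fst c v\<bar> \<le> 2 ^ \<beta>" "\<And>c. c \<in> Cs \<Longrightarrow> \<bar>snd c\<bar> \<le> 2 ^ \<beta>"
    and x: "x \<in> feas V Cs" "\<And>v. v \<in> P \<Longrightarrow> x v \<in> \<int>" "quad V H c x + d \<le> 0"
  shows "small_feasible V P Cs H c d (miqp_exp N \<beta>)"
proof -
  define e1 where "e1 = qp_exp (5 * N + 5) \<beta>"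
  define \<zeta> where "\<zeta> = 2 * N + 1 + e1"
  define \<beta>2 where "\<beta>2 = 2 * N + \<beta> + 2 * e1"
  define e2 where "e2 = qp_exp (2 * (2 * N + 1) + 2) \<beta>2"
  define e3 where "e3 = 2 * N + 1 + e1 + e2"
  define \<zeta>' where "\<zeta>' = \<zeta> + e3 + 1"
  define s where "s = 2 * e2 + 2 * N + \<beta> + 2 * \<zeta>' + e1 + 3"
  define \<xi> where "\<xi> = \<zeta>' + s + e1 + 1"
  have exp: "miqp_exp N \<beta> = escape_exp N \<beta> \<zeta> e3 + qp_exp (6 * N) (\<beta> + \<xi>)"
    unfolding miqp_exp_def Let_def \<xi>_def s_def \<zeta>'_def e3_def e2_def \<beta>2_def \<zeta>_def e1_def ..
  show ?thesis
  proof (cases "small_feasible V P Cs H c d (escape_exp N \<beta> \<zeta> e3)")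
    case True
    then show ?thesis by (rule small_feasible_mono) (simp add: exp)
  next
    case no_escape: False
    define ok where "ok z \<longleftrightarrow> z \<in> feas V Cs \<and> (\<forall>v\<in>P. z v \<in> \<int>) \<and> (\<forall>v\<in>V. \<bar>z v\<bar> \<le> 2 ^ \<zeta>)" for z
    \<comment> \<open>What failure of escape provides: small recession directions have nonnegative
      curvature, and flat ones have nonnegative slope at every small base point.\<close>
    have curv: "bil V H \<rho> \<rho> \<ge> 0" and slope: "bil V H \<rho> \<rho> = 0 \<Longrightarrow> dquad V H c z \<rho> \<ge> 0"
      if "ok z" "recession V Cs \<rho>" "\<And>v. v \<in> V \<Longrightarrow> \<bar>\<rho> v\<bar> \<le> 2 ^ e3" for z \<rho>
    proof -
      have "\<not> (bil V H \<rho> \<rho> < 0 \<or> bil V H \<rho> \<rho> = 0 \<and> dquad V H c z \<rho> < 0)"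
      proof
        assume "bil V H \<rho> \<rho> < 0 \<or> bil V H \<rho> \<rho> = 0 \<and> dquad V H c z \<rho> < 0"
        then have "small_feasible V P Cs H c d (escape_exp N \<beta> \<zeta> e3)"
          using that by (intro escape_small_feasible[OF fin N P, of H \<beta> c d z \<zeta> \<rho> e3])
            (auto simp: ok_def H c d C)
        then show False using no_escape by blast
      qed
      then show "bil V H \<rho> \<rho> \<ge> 0" "bil V H \<rho> \<rho> = 0 \<Longrightarrow> dquad V H c z \<rho> \<ge> 0" by auto
    qed
    obtain I :: "nat set" and r :: "nat \<Rightarrow> 'v \<Rightarrow> int" and K0 :: "nat \<Rightarrow> nat" and z0 :: "'v \<Rightarrow> real" where
      I: "finite I" "card I \<le> 2 * N + 1" and rec: "\<And>i. i \<in> I \<Longrightarrow> recession V Cs (r i)"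
      and r: "\<And>i v. i \<in> I \<Longrightarrow> \<bar>r i v\<bar> \<le> 2 ^ e1"
      and z0: "z0 \<in> feas V Cs" "\<And>v. v \<in> V \<Longrightarrow> \<bar>z0 v\<bar> \<le> 2 ^ \<zeta>"
      and x_eq: "\<And>v. v \<in> V \<Longrightarrow> x v = z0 v + (\<Sum>i\<in>I. real (K0 i) * real_of_int (r i v))"
      unfolding \<zeta>_def e1_def
      by (rule polyhedron_decomposition[OF fin N C x(1)]) blast+
    define comb where "comb J \<mu> v = (\<Sum>i\<in>J. \<mu> i * real_of_int (r i v))" for J \<mu> v
    \<comment> \<open>Minimality is taken over pairs of a small base point and multiplicities. The
      given \<open>x\<close> only starts the search and may be replaced.\<close>
    define cond where "cond zK \<longleftrightarrow> ok (fst zK) \<and>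
        quad V H c (\<lambda>v. fst zK v + comb I (\<lambda>i. real (snd zK i :: nat)) v) + d \<le> 0" for zK
    have "ok z0"
      unfolding ok_def
    proof (intro conjI ballI)
      fix v assume v: "v \<in> P"
      have "z0 v = x v - real_of_int (\<Sum>i\<in>I. int (K0 i) * r i v)" using x_eq[of v] v P by auto
      then show "z0 v \<in> \<int>" using x(2)[OF v] by (metis Ints_diff Ints_of_int)
    qed (use z0 in auto)
    moreover have "quad V H c (\<lambda>v. z0 v + comb I (\<lambda>i. real (K0 i)) v) = quad V H c x"
      by (rule quad_cong) (simp add: comb_def x_eq)
    ultimately have "cond (z0, K0)" using x(3) by (simp add: cond_def)
    then obtain zK where zK: "cond zK" and min: "\<And>zK'. cond zK' \<Longrightarrow> (\<Sum>i\<in>I. snd zK i) \<le> (\<Sum>i\<in>I. snd zK' i)"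
      using ex_has_least_nat[of cond "(z0, K0)" "\<lambda>zK. \<Sum>i\<in>I. snd zK i"] by blast
    define z where "z = fst zK"
    define K where "K = snd zK"
    have z: "ok z" and q: "quad V H c (\<lambda>v. z v + comb I (\<lambda>i. real (K i)) v) + d \<le> 0"
      using zK by (simp_all add: cond_def z_def K_def)
    \<comment> \<open>Gram matrix of the rays, transferring the form to the space of
      multiplicities.\<close>
    define M where "M i j = (\<Sum>u\<in>V. \<Sum>v\<in>V. H u v * r i u * r j v)" for i j
    have bilM: "bil V H (comb J \<mu>) (comb J \<nu>) = bil J M \<mu> \<nu>" for J \<mu> \<nu>
    proof -
      have "bil V H (comb J \<mu>) (comb J \<nu>) = (\<Sum>i\<in>J. \<Sum>j\<in>J. \<mu> i * (\<nu> j * real_of_int (M i j)))"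
        unfolding comb_def[abs_def] bil_sum_left bil_sum_right bil_scale_left bil_scale_right bil_of_int M_def
        by (simp add: sum_distrib_left)
      then show ?thesis by (simp add: bil_def mult_ac)
    qed
    have rR: "\<bar>real_of_int (r i v)\<bar> \<le> 2 ^ e1" if "i \<in> I" for i v
      by (rule abs_of_int_le_power[OF r[OF that]])
    have M: "\<bar>M i j\<bar> \<le> 2 ^ \<beta>2" if ij: "i \<in> I" "j \<in> I" for i j
    proof -
      have "\<bar>real_of_int (M i j)\<bar> = \<bar>bil V H (\<lambda>v. real_of_int (r i v)) (\<lambda>v. real_of_int (r j v))\<bar>"
        unfolding M_def bil_of_int ..
      also have "\<dots> \<le> 2 ^ (N + (N + (\<beta> + e1 + e1)))"
        using ij by (intro abs_bil_le) (auto simp: N H rR)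
      also have "\<dots> = 2 ^ \<beta>2" by (rule arg_cong[where f = "(^) 2"]) (simp add: \<beta>2_def)
      finally show ?thesis by (metis of_int_abs of_int_le_iff of_int_numeral of_int_power)
    qed
    have comb_bound: "\<bar>comb J (\<lambda>i. real (n i)) v\<bar> \<le> 2 ^ e3"
      if J: "J \<subseteq> I" and n: "\<And>i. i \<in> J \<Longrightarrow> n i \<le> 2 ^ e2" for J v and n :: "nat \<Rightarrow> nat"
    proof -
      have "card J \<le> 2 * N + 1" using card_mono[OF I(1) J] I(2) by simp
      then have "\<bar>comb J (\<lambda>i. real (n i)) v\<bar> \<le> 2 ^ ((2 * N + 1) + (e2 + e1))"
        unfolding comb_def
      proof (rule abs_sum_le_power)
        fix i assume i: "i \<in> J"
        have "\<bar>real (n i)\<bar> \<le> 2 ^ e2" using n[OF i] by (simp add: of_nat_le_numeral_power_cancel_iff)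
        then show "\<bar>real (n i) * real_of_int (r i v)\<bar> \<le> 2 ^ (e2 + e1)"
          using rR i J by (intro abs_mult_le_power) auto
      qed
      also have "\<dots> = 2 ^ e3" by (rule arg_cong[where f = "(^) 2"]) (simp add: e3_def)
      finally show ?thesis .
    qed
    have ray: "\<exists>\<rho>. (\<lambda>v. real_of_int (\<rho> v)) = comb J (\<lambda>i. real (n i)) \<and> recession V Cs \<rho> \<and> (\<forall>v\<in>V. \<bar>\<rho> v\<bar> \<le> 2 ^ e3)"
      if J: "J \<subseteq> I" and n: "\<And>i. i \<in> J \<Longrightarrow> n i \<le> 2 ^ e2" for J and n :: "nat \<Rightarrow> nat"
    proof -
      define \<rho> where "\<rho> v = (\<Sum>i\<in>J. int (n i) * r i v)" for v
      have eq: "(\<lambda>v. real_of_int (\<rho> v)) = comb J (\<lambda>i. real (n i))"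
        by (auto simp: \<rho>_def comb_def)
      have "recession V Cs \<rho>"
        unfolding recession_def eq
      proof
        fix c assume "c \<in> Cs"
        then have "real (n i) * lin V (fst c) (\<lambda>v. real_of_int (r i v)) \<le> 0" if "i \<in> J" for i
          using rec[of i] that J by (intro mult_nonneg_nonpos) (auto simp: recession_def)
        then show "lin V (fst c) (comb J (\<lambda>i. real (n i))) \<le> 0"
          unfolding comb_def[abs_def] lin_sum lin_scale by (rule sum_nonpos)
      qed
      moreover have "\<bar>\<rho> v\<bar> \<le> 2 ^ e3" for v
      proof -
        have "\<bar>real_of_int (\<rho> v)\<bar> \<le> 2 ^ e3" using comb_bound[OF J n, where v = v] fun_cong[OF eq, of v] by simp
        then show ?thesis by (metis of_int_abs of_int_le_iff of_int_numeral of_int_power)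
      qed
      ultimately show ?thesis using eq by blast
    qed
    have simplex: "\<exists>(t::int) n::nat \<Rightarrow> nat. 1 \<le> t \<and> t \<le> 2 ^ e2 \<and> (\<forall>i. n i \<le> 2 ^ e2) \<and> (\<Sum>i\<in>J. int (n i)) = t \<and>
        (\<forall>\<mu>. (\<forall>i\<in>J. 0 \<le> \<mu> i) \<longrightarrow> (\<Sum>i\<in>J. \<mu> i)\<^sup>2 * bil J M n n \<le> (real_of_int t)\<^sup>2 * bil J M \<mu> \<mu>)"
      if J: "J \<subseteq> I" "J \<noteq> {}" for J
    proof -
      have J': "finite J" "card J \<le> 2 * N + 1"
        using J(1) I card_mono[OF I(1) J(1)] finite_subset by auto
      have MJ: "\<And>i j. i \<in> J \<Longrightarrow> j \<in> J \<Longrightarrow> \<bar>M i j\<bar> \<le> 2 ^ \<beta>2" using M J by blast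
      show ?thesis
        unfolding e2_def
        by (rule simplex_small_minimizer[OF J'(1) J(2) J'(2), of M \<beta>2]) (use MJ in blast)+
    qed
    \<comment> \<open>The simplex minimiser yields a small ray, whose curvature is nonnegative; by
      minimality this extends to all nonnegative, also real, multiplicities.\<close>
    have copos: "0 \<le> bil V H (comb I \<mu>) (comb I \<mu>)" if \<mu>: "\<And>i. i \<in> I \<Longrightarrow> 0 \<le> \<mu> i" for \<mu>
    proof (cases "I = {}")
      case True
      then show ?thesis by (simp add: comb_def[abs_def] bil_def)
    next
      case False
      then obtain t :: int and n :: "nat \<Rightarrow> nat" where tn: "1 \<le> t" "\<forall>i. n i \<le> 2 ^ e2"
        "(\<Sum>i\<in>I. \<mu> i)\<^sup>2 * bil I M n n \<le> (real_of_int t)\<^sup>2 * bil I M \<mu> \<mu>"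
        using simplex[of I] \<mu> by blast
      obtain \<rho> where \<rho>: "(\<lambda>v. real_of_int (\<rho> v)) = comb I (\<lambda>i. real (n i))" "recession V Cs \<rho>" "\<forall>v\<in>V. \<bar>\<rho> v\<bar> \<le> 2 ^ e3"
        using ray[of I n] tn(2) by blast
      have "0 \<le> bil I M n n" using curv[OF z \<rho>(2)] \<rho>(3) unfolding \<rho>(1) bilM by blast
      then have "0 \<le> (real_of_int t)\<^sup>2 * bil I M \<mu> \<mu>" using tn(3) by (meson order_trans mult_nonneg_nonneg zero_le_power2)
      then have "0 \<le> bil I M \<mu> \<mu>" using tn(1) by (simp add: zero_le_mult_iff)
      then show ?thesis by (simp add: bilM)
    qed
    \<comment> \<open>The threshold is the bound on the numerators of simplex minimisers, so these
      can be subtracted from \<open>K\<close> on \<open>J\<close> within the natural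
      numbers.\<close>
    define J where "J = {i\<in>I. 2 ^ e2 \<le> K i}"
    have J: "J \<subseteq> I" "finite J" using I by (auto simp: J_def)
    define \<sigma> where "\<sigma> = (\<Sum>i\<in>J. real (K i))"
    have \<sigma>0: "\<sigma> \<ge> 0" by (simp add: \<sigma>_def sum_nonneg)
    \<comment> \<open>Quantitative strict copositivity: the minimum of the form on the simplex over
      \<open>J\<close> is \<open>w / t^2\<close> with a positive integer \<open>w\<close> and
      \<open>t\<close> at most \<open>2 ^ e2\<close>.\<close>
    have growth: "\<sigma>\<^sup>2 \<le> 2 ^ (2 * e2) * bil J M (\<lambda>i. real (K i)) (\<lambda>i. real (K i))"
    proof (cases "J = {}")
      case True
      then show ?thesis by (simp add: \<sigma>_def bil_def)
    next
      case False
      then obtain t :: int and n :: "nat \<Rightarrow> nat" where t: "1 \<le> t" "t \<le> 2 ^ e2" and n: "\<And>i. n i \<le> 2 ^ e2"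
        and nt: "(\<Sum>i\<in>J. int (n i)) = t"
        and opt: "\<sigma>\<^sup>2 * bil J M n n \<le> (real_of_int t)\<^sup>2 * bil J M (\<lambda>i. real (K i)) (\<lambda>i. real (K i))"
        using simplex[OF J(1)] unfolding \<sigma>_def by (metis of_nat_0_le_iff)
      obtain \<rho> where \<rho>: "(\<lambda>v. real_of_int (\<rho> v)) = comb J (\<lambda>i. real (n i))" "recession V Cs \<rho>" "\<forall>v\<in>V. \<bar>\<rho> v\<bar> \<le> 2 ^ e3"
        using ray[OF J(1), of n] n by blast
      define w where "w = (\<Sum>u\<in>V. \<Sum>v\<in>V. H u v * \<rho> u * \<rho> v)"
      have w: "bil J M n n = real_of_int w" unfolding bilM[symmetric] \<rho>(1)[symmetric] w_def by (rule bil_of_int)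
      have w0: "0 \<le> bil J M n n" using curv[OF z \<rho>(2)] \<rho>(3) unfolding \<rho>(1) bilM by blast
      \<comment> \<open>otherwise \<open>n\<close> is a zero of the form and can be subtracted from \<open>K\<close>, against minimality\<close>
      have "w \<noteq> 0"
      proof
        assume "w = 0"
        then have flat: "bil V H (comb J (\<lambda>i. real (n i))) (comb J (\<lambda>i. real (n i))) = 0"
          by (simp add: bilM w)
        define n' where "n' i = (if i \<in> J then n i else 0)" for i
        define K' where "K' i = K i - n' i" for i
        have n'K: "n' i \<le> K i" if "i \<in> I" for i
          using n[of i] by (auto simp: n'_def J_def intro: order_trans)
        define \<kappa> where "\<kappa> = comb I (\<lambda>i. real (K i))"
        define \<omega> where "\<omega> = comb I (\<lambda>i. real (n' i))"
        have \<omega>J: "\<omega> = comb J (\<lambda>i. real (n i))"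
        proof
          fix v
          show "\<omega> v = comb J (\<lambda>i. real (n i)) v"
            unfolding \<omega>_def comb_def using I(1) J(1)
            by (intro sum.mono_neutral_cong_right) (auto simp: n'_def)
        qed
        \<comment> \<open>At the zero \<open>\<omega>\<close> the copositive form is minimal, so its
          derivative towards the admissible direction \<open>\<kappa>\<close> is
          nonnegative.\<close>
        have "0 \<le> bil V H \<omega> \<kappa> + bil V H \<kappa> \<omega>"
        proof (rule linear_coeff_nonneg)
          fix s :: real assume "s > 0"
          then have "0 \<le> bil V H (comb I (\<lambda>i. real (n' i) + s * real (K i))) (comb I (\<lambda>i. real (n' i) + s * real (K i)))"
            by (intro copos) auto
          also have "comb I (\<lambda>i. real (n' i) + s * real (K i)) = (\<lambda>v. \<omega> v + s * \<kappa> v)"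
            by (rule ext) (simp add: \<omega>_def \<kappa>_def comb_def algebra_simps sum.distrib sum_distrib_left)
          finally show "0 \<le> s * (bil V H \<omega> \<kappa> + bil V H \<kappa> \<omega>) + s\<^sup>2 * bil V H \<kappa> \<kappa>"
            using flat by (simp add: bil_add_left bil_add_right bil_scale_left bil_scale_right
                \<omega>J[symmetric] power2_eq_square algebra_simps)
        qed
        moreover have "0 \<le> dquad V H c z \<omega>"
          using slope[OF z \<rho>(2)] \<rho>(3) flat unfolding \<rho>(1) \<omega>J by blast
        ultimately have "0 \<le> dquad V H c (\<lambda>v. z v + \<kappa> v) \<omega>"
          by (simp add: dquad_def bil_add_left bil_add_right)
        \<comment> \<open>Stepping back by \<open>\<omega>\<close> subtracts the nonnegative slope
          and adds no curvature, so the objective does not increase.\<close>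
        then have "quad V H c (\<lambda>v. (z v + \<kappa> v) + (-1) * \<omega> v) + d \<le> 0"
          unfolding quad_line using q flat by (simp add: \<kappa>_def[symmetric] \<omega>J[symmetric])
        moreover have "(\<lambda>v. (z v + \<kappa> v) + (-1) * \<omega> v) = (\<lambda>v. z v + comb I (\<lambda>i. real (K' i)) v)"
        proof
          fix v
          have "comb I (\<lambda>i. real (K' i)) v = (\<Sum>i\<in>I. real (K i) * real_of_int (r i v) - real (n' i) * real_of_int (r i v))"
            unfolding comb_def by (intro sum.cong) (auto simp: K'_def n'K of_nat_diff left_diff_distrib)
          then show "(z v + \<kappa> v) + (-1) * \<omega> v = z v + comb I (\<lambda>i. real (K' i)) v"
            by (simp add: \<kappa>_def \<omega>_def comb_def sum_subtractf)
        qed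
        ultimately have "cond (z, K')" using z by (simp add: cond_def)
        then have "(\<Sum>i\<in>I. K i) \<le> (\<Sum>i\<in>I. K' i)" using min[of "(z, K')"] by (simp add: K_def)
        moreover have "(\<Sum>i\<in>I. K i) = (\<Sum>i\<in>I. K' i) + (\<Sum>i\<in>I. n' i)"
          unfolding sum.distrib[symmetric] by (intro sum.cong) (auto simp: K'_def n'K)
        moreover have "(\<Sum>i\<in>I. n' i) = (\<Sum>i\<in>J. n i)"
          using I(1) J(1) by (intro sum.mono_neutral_cong_right) (auto simp: n'_def)
        moreover have "(\<Sum>i\<in>J. n i) \<ge> 1" using nt t(1) by (simp flip: of_nat_sum)
        ultimately show False by linarith
      qed
      then have "1 \<le> bil J M n n" using w w0 by simp
      then have "\<sigma>\<^sup>2 * 1 \<le> \<sigma>\<^sup>2 * bil J M n n" by (intro mult_left_mono) auto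
      also have "\<dots> \<le> (real_of_int t)\<^sup>2 * bil J M (\<lambda>i. real (K i)) (\<lambda>i. real (K i))" by (rule opt)
      also have "\<dots> \<le> 2 ^ (2 * e2) * bil J M (\<lambda>i. real (K i)) (\<lambda>i. real (K i))"
      proof (rule mult_right_mono)
        have "real_of_int t \<le> 2 ^ e2" using t(2) by (metis of_int_le_iff of_int_numeral of_int_power)
        then have "(real_of_int t)\<^sup>2 \<le> (2 ^ e2)\<^sup>2" using t(1) by (intro power_mono) auto
        then show "(real_of_int t)\<^sup>2 \<le> 2 ^ (2 * e2)" by (simp add: power_mult[symmetric] mult.commute)
        have "0 \<le> bil V H (comb I (\<lambda>i. if i \<in> J then real (K i) else 0)) (comb I (\<lambda>i. if i \<in> J then real (K i) else 0))"
          by (intro copos) auto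
        also have "comb I (\<lambda>i. if i \<in> J then real (K i) else 0) = comb J (\<lambda>i. real (K i))"
        proof
          fix v
          show "comb I (\<lambda>i. if i \<in> J then real (K i) else 0) v = comb J (\<lambda>i. real (K i)) v"
            unfolding comb_def using I(1) J(1) by (intro sum.mono_neutral_cong_right) auto
        qed
        finally show "0 \<le> bil J M (\<lambda>i. real (K i)) (\<lambda>i. real (K i))" by (simp add: bilM)
      qed
      finally show ?thesis by simp
    qed
    \<comment> \<open>Rays outside \<open>J\<close> have multiplicities below \<open>2 ^ e2\<close>
      and are absorbed into the base point; only the part over \<open>J\<close> remains to be
      bounded.\<close>
    define z' where "z' v = z v + comb (I - J) (\<lambda>i. real (K i)) v" for v
    define \<kappa> where "\<kappa> = comb J (\<lambda>i. real (K i))"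
    define X where "X v = z' v + 1 * \<kappa> v" for v
    have X: "X = (\<lambda>v. z v + comb I (\<lambda>i. real (K i)) v)"
    proof
      fix v
      show "X v = z v + comb I (\<lambda>i. real (K i)) v"
        unfolding X_def z'_def \<kappa>_def comb_def 
        by (simp add: sum.subset_diff[OF J(1) I(1), where g = "\<lambda>i. real (K i) * real_of_int (r i v)"])
    qed
    have z'b: "\<bar>z' v\<bar> \<le> 2 ^ \<zeta>'" if v: "v \<in> V" for v
    proof -
      have "\<bar>comb (I - J) (\<lambda>i. real (K i)) v\<bar> \<le> 2 ^ e3"
        by (rule comb_bound) (auto simp: J_def)
      moreover have "\<bar>z v\<bar> \<le> 2 ^ \<zeta>" using z v by (simp add: ok_def)
      moreover have "(2::real) ^ e3 \<le> 2 ^ (\<zeta> + e3)" "(2::real) ^ \<zeta> \<le> 2 ^ (\<zeta> + e3)" by (rule power2_mono, simp)+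
      ultimately have "\<bar>z' v\<bar> \<le> 2 ^ (\<zeta> + e3) + 2 ^ (\<zeta> + e3)" unfolding z'_def by linarith
      then show ?thesis by (simp add: \<zeta>'_def)
    qed
    define k where "k = 2 * N + \<beta> + 2 * \<zeta>' + e1 + 2"
    have q0: "\<bar>quad V H c z' + d\<bar> \<le> 2 ^ k"
      by (rule order_trans[OF abs_quad_le[of V N H \<beta> c d z' \<zeta>']])
        (auto simp: N H c d z'b k_def intro!: power2_mono)
    have slope_i: "\<bar>dquad V H c z' (\<lambda>v. real_of_int (r i v))\<bar> \<le> 2 ^ k" if "i \<in> I" for i
      by (rule order_trans[OF abs_dquad_le[of V N H \<beta> c z' \<zeta>' _ e1]])
        (use that in \<open>auto simp: N H c z'b rR k_def intro!: power2_mono\<close>)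
    have dsum: "dquad V H c z' (comb A \<mu>) = (\<Sum>i\<in>A. \<mu> i * dquad V H c z' (\<lambda>v. real_of_int (r i v)))" for A \<mu>
      unfolding comb_def[abs_def] dquad_def bil_sum_left bil_sum_right lin_sum bil_scale_left bil_scale_right lin_scale
      by (simp add: distrib_left sum.distrib)
    have "\<bar>dquad V H c z' \<kappa>\<bar> \<le> (\<Sum>i\<in>J. \<bar>real (K i) * dquad V H c z' (\<lambda>v. real_of_int (r i v))\<bar>)"
      unfolding \<kappa>_def dsum by (rule sum_abs)
    also have "\<dots> \<le> (\<Sum>i\<in>J. real (K i) * 2 ^ k)"
      unfolding abs_mult using slope_i J(1) by (intro sum_mono mult_mono) auto
    also have "\<dots> = \<sigma> * 2 ^ k" by (simp add: \<sigma>_def sum_distrib_right)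
    finally have d0: "\<bar>dquad V H c z' \<kappa>\<bar> \<le> \<sigma> * 2 ^ k" .
    have qX: "quad V H c X + d \<le> 0" using q by (simp add: X)
    have "bil V H \<kappa> \<kappa> \<le> 2 ^ k + \<sigma> * 2 ^ k"
      using qX q0 d0 unfolding X_def[abs_def] quad_line by simp
    then have "2 ^ (2 * e2) * bil V H \<kappa> \<kappa> \<le> 2 ^ (2 * e2) * (2 ^ k + \<sigma> * 2 ^ k)" by (intro mult_left_mono) auto
    \<comment> \<open>The square of \<open>\<sigma>\<close> is bounded by an affine function of
      \<open>\<sigma>\<close>: the form grows quadratically, the remaining terms of the objective
      only linearly.\<close>
    then have sq: "\<sigma>\<^sup>2 \<le> 2 ^ (2 * e2) * (2 ^ k + \<sigma> * 2 ^ k)"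
      using growth unfolding \<kappa>_def bilM by linarith
    have \<sigma>b: "\<sigma> \<le> 2 ^ s"
    proof (cases "\<sigma> \<le> 1")
      case True
      then show ?thesis by (rule order_trans) simp
    next
      case False
      have "2 ^ k + \<sigma> * 2 ^ k \<le> \<sigma> * 2 ^ k + \<sigma> * 2 ^ k" using False by simp
      also have "\<dots> = \<sigma> * 2 ^ (k + 1)" by simp
      finally have "\<sigma>\<^sup>2 \<le> 2 ^ (2 * e2) * (\<sigma> * 2 ^ (k + 1))"
        using sq by (meson mult_left_mono order_trans zero_le_numeral zero_le_power)
      then have "\<sigma> * \<sigma> \<le> \<sigma> * 2 ^ (2 * e2 + (k + 1))" by (simp add: power2_eq_square power_add mult_ac)
      then have "\<sigma> \<le> 2 ^ (2 * e2 + (k + 1))" using False by simp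
      also have "2 * e2 + (k + 1) = s" by (simp add: s_def k_def)
      finally show ?thesis .
    qed
    have Xb: "\<bar>X v\<bar> \<le> 2 ^ \<xi>" if v: "v \<in> V" for v
    proof -
      have "\<bar>\<kappa> v\<bar> \<le> (\<Sum>i\<in>J. \<bar>real (K i) * real_of_int (r i v)\<bar>)" unfolding \<kappa>_def comb_def by (rule sum_abs)
      also have "\<dots> \<le> (\<Sum>i\<in>J. real (K i) * 2 ^ e1)"
        unfolding abs_mult using rR J(1) by (intro sum_mono mult_mono) auto
      also have "\<dots> = \<sigma> * 2 ^ e1" by (simp add: \<sigma>_def sum_distrib_right)
      also have "\<dots> \<le> 2 ^ s * 2 ^ e1" using \<sigma>b by (intro mult_right_mono) auto
      also have "\<dots> \<le> 2 ^ (\<zeta>' + s + e1)" unfolding power_add[symmetric] by (rule power2_mono) simp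
      finally have "\<bar>\<kappa> v\<bar> \<le> 2 ^ (\<zeta>' + s + e1)" .
      moreover have "(2::real) ^ \<zeta>' \<le> 2 ^ (\<zeta>' + s + e1)" by (rule power2_mono) simp
      ultimately have "\<bar>X v\<bar> \<le> 2 ^ (\<zeta>' + s + e1) + 2 ^ (\<zeta>' + s + e1)" using z'b[OF v] unfolding X_def by linarith
      then show ?thesis by (simp add: \<xi>_def)
    qed
    have XZ: "X v \<in> \<int>" if v: "v \<in> P" for v
    proof -
      have "X v = z v + real_of_int (\<Sum>i\<in>I. int (K i) * r i v)" by (simp add: X comb_def)
      then show ?thesis using z v unfolding ok_def by (metis Ints_add Ints_of_int)
    qed
    have Xf: "X \<in> feas V Cs"
      unfolding feas_def mem_Collect_eq X lin_add
    proof
      fix c assume c: "c \<in> Cs"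
      have "lin V (fst c) (comb I (\<lambda>i. real (K i))) = (\<Sum>i\<in>I. real (K i) * lin V (fst c) (\<lambda>v. real_of_int (r i v)))"
        unfolding comb_def[abs_def] lin_sum lin_scale ..
      also have "\<dots> \<le> 0"
        using rec c by (intro sum_nonpos mult_nonneg_nonpos) (auto simp: recession_def)
      finally show "lin V (fst c) z + lin V (fst c) (comb I (\<lambda>i. real (K i))) \<le> real_of_int (snd c)"
        using z c by (force simp: ok_def feas_def)
    qed
    have mono: "i \<le> 2 ^ \<beta> \<Longrightarrow> i \<le> (2::int) ^ (\<beta> + \<xi>)" for i
      by (rule order_trans[OF _ power_increasing]) auto
    obtain t :: int and n :: "'v \<Rightarrow> int" where tn: "t \<ge> 1" "t \<le> 2 ^ qp_exp (6 * N) (\<beta> + \<xi>)"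
      "\<And>v. \<bar>n v\<bar> \<le> 2 ^ qp_exp (6 * N) (\<beta> + \<xi>)" "(\<lambda>v. n v / t) \<in> feas V Cs"
      "\<And>v. v \<in> P \<Longrightarrow> n v / t \<in> \<int>"
      "quad V H c (\<lambda>v. n v / t) \<le> quad V H c X"
    proof (rule fibre_small_minimizer[OF fin N P, where Q = H and g = c and \<beta> = "\<beta> + \<xi>" and x = X and \<xi> = \<xi>])
      show "\<bar>H u v\<bar> \<le> 2 ^ (\<beta> + \<xi>)" if "u \<in> V" "v \<in> V" for u v using mono H that by blast
      show "\<bar>c v\<bar> \<le> 2 ^ (\<beta> + \<xi>)" if "v \<in> V" for v using mono c that by blast
      show "\<bar>fst c v\<bar> \<le> 2 ^ (\<beta> + \<xi>)" if "c \<in> Cs" "v \<in> V" for c v using mono C that by blast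
      show "\<bar>snd c\<bar> \<le> 2 ^ (\<beta> + \<xi>)" if "c \<in> Cs" for c using mono C that by blast
    qed (use Xf XZ Xb in auto)
    have "small_feasible V P Cs H c d (qp_exp (6 * N) (\<beta> + \<xi>))"
      unfolding small_feasible_def using tn qX by (intro exI[of _ t] exI[of _ n]) auto
    then show ?thesis by (rule small_feasible_mono) (simp add: exp)
  qed
qed

section \<open>Encoding sizes\<close>

text \<open>The nested exponents are never expanded into an explicit polynomial; closure under
  constants, sums and products is enough.\<close>

definition polynomial_fun :: "(nat \<Rightarrow> nat) \<Rightarrow> bool" where
  "polynomial_fun g \<longleftrightarrow> (\<exists>f :: real poly. \<forall>k. real (g k) = poly f (real k))"

lemma polynomial_fun_const: "polynomial_fun (\<lambda>_. a)"
  unfolding polynomial_fun_def by (intro exI[of _ "[:real a:]"]) simp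

lemma polynomial_fun_id: "polynomial_fun (\<lambda>k. k)"
  unfolding polynomial_fun_def by (intro exI[of _ "[:0, 1:]"]) simp

lemma polynomial_fun_add: "polynomial_fun g \<Longrightarrow> polynomial_fun h \<Longrightarrow> polynomial_fun (\<lambda>k. g k + h k)"
  unfolding polynomial_fun_def by (metis of_nat_add poly_add)

lemma polynomial_fun_mult: "polynomial_fun g \<Longrightarrow> polynomial_fun h \<Longrightarrow> polynomial_fun (\<lambda>k. g k * h k)"
  unfolding polynomial_fun_def by (metis of_nat_mult poly_mult)

lemmas polynomial_fun_intros =
  polynomial_fun_const polynomial_fun_id polynomial_fun_add polynomial_fun_mult

lemma polynomial_fun_qp_exp:
  "polynomial_fun N \<Longrightarrow> polynomial_fun \<beta> \<Longrightarrow> polynomial_fun (\<lambda>k. qp_exp (N k) (\<beta> k))"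
  unfolding qp_exp_def by (intro polynomial_fun_intros)

lemma polynomial_fun_escape_exp:
  assumes "polynomial_fun N" "polynomial_fun \<beta>" "polynomial_fun \<zeta>" "polynomial_fun \<epsilon>"
  shows "polynomial_fun (\<lambda>k. escape_exp (N k) (\<beta> k) (\<zeta> k) (\<epsilon> k))"
  unfolding escape_exp_def Let_def
  by (intro polynomial_fun_intros polynomial_fun_qp_exp assms)

lemma polynomial_fun_miqp_exp:
  assumes N: "polynomial_fun N" and \<beta>: "polynomial_fun \<beta>"
  shows "polynomial_fun (\<lambda>k. miqp_exp (N k) (\<beta> k))"
proof -
  note intros = polynomial_fun_intros polynomial_fun_qp_exp polynomial_fun_escape_exp N \<beta>
  define e1 where "e1 k = qp_exp (5 * N k + 5) (\<beta> k)" for k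
  have e1: "polynomial_fun e1" unfolding e1_def[abs_def] by (intro intros)
  define \<zeta> where "\<zeta> k = 2 * N k + 1 + e1 k" for k
  have \<zeta>: "polynomial_fun \<zeta>" unfolding \<zeta>_def[abs_def] by (intro intros e1)
  define e2 where "e2 k = qp_exp (2 * (2 * N k + 1) + 2) (2 * N k + \<beta> k + 2 * e1 k)" for k
  have e2: "polynomial_fun e2" unfolding e2_def[abs_def] by (intro intros e1)
  define e3 where "e3 k = 2 * N k + 1 + e1 k + e2 k" for k
  have e3: "polynomial_fun e3" unfolding e3_def[abs_def] by (intro intros e1 e2)
  define \<zeta>' where "\<zeta>' k = \<zeta> k + e3 k + 1" for k
  have \<zeta>': "polynomial_fun \<zeta>'" unfolding \<zeta>'_def[abs_def] by (intro intros \<zeta> e3)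
  define \<sigma> where "\<sigma> k = 2 * e2 k + 2 * N k + \<beta> k + 2 * \<zeta>' k + e1 k + 3" for k
  have \<sigma>: "polynomial_fun \<sigma>" unfolding \<sigma>_def[abs_def] by (intro intros e1 e2 \<zeta>')
  define \<xi> where "\<xi> k = \<zeta>' k + \<sigma> k + e1 k + 1" for k
  have \<xi>: "polynomial_fun \<xi>" unfolding \<xi>_def[abs_def] by (intro intros e1 \<sigma> \<zeta>')
  have "(\<lambda>k. miqp_exp (N k) (\<beta> k)) =
      (\<lambda>k. escape_exp (N k) (\<beta> k) (\<zeta> k) (e3 k) + qp_exp (6 * N k) (\<beta> k + \<xi> k))"
    unfolding miqp_exp_def Let_def \<xi>_def \<sigma>_def \<zeta>'_def e3_def e2_def \<zeta>_def e1_def ..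
  then show ?thesis by (simp only:) (intro intros \<zeta> e3 \<xi>)
qed

section \<open>Passing between bit sizes and integer data\<close>

lemma less_power_floorlog: "k < 2 ^ floorlog 2 k"
  using floorlog_le_iff[of 2 k "floorlog 2 k"] by simp

lemma quotient_of_bounds:
  fixes r :: rat
  shows "0 < snd (quotient_of r)" "snd (quotient_of r) \<le> 2 ^ rat_complexity r"
    "\<bar>fst (quotient_of r)\<bar> \<le> 2 ^ rat_complexity r"
proof -
  obtain a q where aq: "quotient_of r = (a, q)" by fastforce
  have q: "q > 0" using aq by (rule quotient_of_denom_pos)
  have le: "k \<le> 2 ^ rat_complexity r" if "floorlog 2 k \<le> rat_complexity r" for k :: nat
    using less_power_floorlog[of k] power_increasing[OF that, of "2::nat"] by linarith
  have "nat q \<le> 2 ^ rat_complexity r" "nat \<bar>a\<bar> \<le> 2 ^ rat_complexity r"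
    by (rule le, simp add: rat_complexity_eq[OF aq])+
  then show "0 < snd (quotient_of r)" "snd (quotient_of r) \<le> 2 ^ rat_complexity r"
    "\<bar>fst (quotient_of r)\<bar> \<le> 2 ^ rat_complexity r"
    using q by (simp_all add: aq nat_le_iff)
qed

text \<open>The product of all denominators has at most \<open>S\<close> bits because complexities
  add up. Writing it as \<open>q * m\<close> for an entry \<open>a / q\<close>, the scaled entry is
  \<open>a * m\<close>, a product of two factors of at most \<open>2 ^ S\<close>.\<close>

lemma common_denominator:
  fixes L :: "rat list"
  defines "S \<equiv> (\<Sum>r\<leftarrow>L. rat_complexity r)"
  obtains D :: int where "1 \<le> D"
    "\<And>r. r \<in> set L \<Longrightarrow> \<exists>k::int. of_int k = r * of_int D \<and> \<bar>k\<bar> \<le> 2 ^ (2 * S)"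
proof -
  define D where "D = (\<Prod>r\<leftarrow>L. snd (quotient_of r))"
  have D: "1 \<le> D \<and> D \<le> 2 ^ S"
    unfolding D_def S_def
  proof (induction L)
    case (Cons r L)
    have "1 * 1 \<le> snd (quotient_of r) * (\<Prod>r\<leftarrow>L. snd (quotient_of r))"
      using Cons quotient_of_bounds(1)[of r] by (intro mult_mono) auto
    moreover have "snd (quotient_of r) * (\<Prod>r\<leftarrow>L. snd (quotient_of r))
        \<le> 2 ^ rat_complexity r * 2 ^ (\<Sum>r\<leftarrow>L. rat_complexity r)"
      using Cons quotient_of_bounds(1,2)[of r] by (intro mult_mono) auto
    ultimately show ?case by (simp add: power_add)
  qed simp
  show thesis
  proof (rule that[of D])
    show "1 \<le> D" using D by simp
    fix r assume r: "r \<in> set L"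
    obtain a q where aq: "quotient_of r = (a, q)" by fastforce
    have q: "q > 0" using aq by (rule quotient_of_denom_pos)
    have rq: "r = of_int a / of_int q" using aq by (rule quotient_of_div)
    have "q dvd D"
      unfolding D_def using r aq by (intro prod_list_dvd) force
    then obtain m where m: "D = q * m" by blast
    have "m \<ge> 1" using D q m by (smt (verit) zero_less_mult_iff)
    then have mD: "m \<le> D" using q m by (simp add: mult_le_cancel_right1)
    have "of_int (a * m) = r * of_int D" using q by (simp add: rq m)
    moreover have "\<bar>a * m\<bar> \<le> 2 ^ (S + S)"
    proof (rule abs_mult_le_power)
      have "rat_complexity r \<le> S" unfolding S_def using r by (intro member_le_sum_list) auto
      then have "(2::int) ^ rat_complexity r \<le> 2 ^ S" by (rule power_increasing) simp
      then show "\<bar>a\<bar> \<le> 2 ^ S" using quotient_of_bounds(3)[of r] aq by (simp only: fst_conv order_trans)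
      show "\<bar>m\<bar> \<le> 2 ^ S" using mD D \<open>m \<ge> 1\<close> by simp
    qed
    ultimately show "\<exists>k::int. of_int k = r * of_int D \<and> \<bar>k\<bar> \<le> 2 ^ (2 * S)"
      by (intro exI[of _ "a * m"]) (simp add: mult_2)
  qed
qed

text \<open>The fraction need not be reduced, since complexity is a minimum over all encodings. The
  bound counts a sign bit and two numbers of at most \<open>e + 1\<close> bits.\<close>

lemma rat_complexity_quotient_le:
  assumes "1 \<le> t" "t \<le> 2 ^ e" "\<bar>a\<bar> \<le> 2 ^ e"
  shows "rat_complexity (of_int a / of_int t) \<le> 2 * e + 3"
proof -
  obtain A where A: "bits_val A = nat \<bar>a\<bar>" "length A = floorlog 2 (nat \<bar>a\<bar>)" using ex_bits_val by blast
  obtain T where T: "bits_val T = nat t" "length T = floorlog 2 (nat t)" using ex_bits_val by blast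
  have "encodes_rat (a < 0, A, T) (of_int a / of_int t)"
    using assms(1) by (simp add: A T of_nat_nat)
  then have "rat_complexity (of_int a / of_int t) \<le> rat_code_size (a < 0, A, T)"
    unfolding rat_complexity_def by (intro Least_le) blast
  also have "\<dots> = 1 + length A + length T" by simp
  also have "\<dots> \<le> 1 + (e + 1) + (e + 1)"
  proof -
    have "floorlog 2 k \<le> e + 1" if "int k \<le> 2 ^ e" for k
    proof -
      have "k \<le> 2 ^ e" using that by (metis of_nat_le_iff of_nat_numeral of_nat_power)
      then have "k < 2 ^ (e + 1)" by (rule le_less_trans) simp
      then show ?thesis by (simp add: floorlog_le_iff)
    qed
    then show ?thesis using assms by (intro add_mono) (simp_all add: A T)
  qed
  finally show ?thesis by simp
qed

text \<open>Scaling all data by one positive common denominator preserves every inequality and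
  reduces to integer data with entries up to \<open>2 ^ (2 * \<phi>)\<close>, where the preceding
  bounds apply with \<open>N = \<phi>\<close>.\<close>

theorem theorem1:
  shows "\<exists>f :: real poly.
    \<forall>(n::nat) (p::nat) (m::nat) (H :: rat mat) (c :: rat vec) (d :: rat) (A :: rat mat) (b :: rat vec).
      0 < n \<and> 0 < p \<and> p \<le> n \<and>
      H \<in> carrier_mat n n \<and> transpose_mat H = H \<and> c \<in> carrier_vec n \<and>
      A \<in> carrier_mat m n \<and> b \<in> carrier_vec m \<and>
      miqp_feasible n p H c d A b \<noteq> {} \<longrightarrow>
      (\<exists>x0 :: rat vec.
         map_vec of_rat x0 \<in> miqp_feasible n p H c d A b \<and>
         real (vec_complexity x0) \<le> poly f (real (miqp_complexity H c d A b)))"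
proof -
  \<comment> \<open>At most \<open>k\<close> entries, each of complexity at most
    \<open>2 * e + 3\<close> plus the extra bit per vector entry, where
    \<open>e = miqp_exp k (2 * k)\<close>.\<close>
  have "polynomial_fun (\<lambda>k. k * (2 * miqp_exp k (2 * k) + 4))"
    by (intro polynomial_fun_intros polynomial_fun_miqp_exp)
  then obtain f where f: "\<And>k. real (k * (2 * miqp_exp k (2 * k) + 4)) = poly f (real k)"
    unfolding polynomial_fun_def by blast
  show ?thesis
  proof (intro exI[of _ f] allI impI, elim conjE)
    fix n p m :: nat and H A :: "rat mat" and c b :: "rat vec" and d :: rat
    assume p: "p \<le> n" and H: "H \<in> carrier_mat n n" and c: "c \<in> carrier_vec n"
      and A: "A \<in> carrier_mat m n" and b: "b \<in> carrier_vec m"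
      and "miqp_feasible n p H c d A b \<noteq> {}"
    then obtain x where x: "x \<in> miqp_feasible n p H c d A b" by blast
    define \<phi> where "\<phi> = miqp_complexity H c d A b"
    \<comment> \<open>A list keeps multiplicities, so its total complexity stays comparable with
      \<open>\<phi>\<close> term by term.\<close>
    define L where "L = concat (map list_of_vec (rows H)) @ list_of_vec c @ [d] @
      concat (map list_of_vec (rows A)) @ list_of_vec b"
    define S where "S = (\<Sum>r\<leftarrow>L. rat_complexity r)"
    have vec: "(\<Sum>r\<leftarrow>list_of_vec v. rat_complexity r) \<le> vec_complexity v" for v
      unfolding vec_complexity_list by (intro sum_list_mono) simp
    have "(\<Sum>r\<leftarrow>concat (map list_of_vec vs). rat_complexity r) \<le> (\<Sum>v\<leftarrow>vs. vec_complexity v)" for vs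
      by (induction vs) (simp_all add: add_mono vec)
    then have mat: "(\<Sum>r\<leftarrow>concat (map list_of_vec (rows M)). rat_complexity r) \<le> mat_complexity M" for M
      unfolding mat_complexity_list .
    have S\<phi>: "S \<le> \<phi>"
      unfolding S_def L_def \<phi>_def miqp_complexity_def
      using vec[of c] vec[of b] mat[of H] mat[of A] by simp
    \<comment> \<open>Every entry of \<open>c\<close> and \<open>b\<close> costs at least one bit,
      so the dimensions are controlled by \<open>\<phi>\<close> as well.\<close>
    have n\<phi>: "n \<le> \<phi>" and m\<phi>: "m \<le> \<phi>"
      using c b by (auto simp: \<phi>_def miqp_complexity_def vec_complexity_eq)
    obtain D :: int where D: "1 \<le> D"
      and "\<And>r. r \<in> set L \<Longrightarrow> \<exists>k::int. of_int k = r * of_int D \<and> \<bar>k\<bar> \<le> 2 ^ (2 * S)"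
      using common_denominator[of L] unfolding S_def by blast
    then obtain sc :: "rat \<Rightarrow> int" where sc: "\<And>r. r \<in> set L \<Longrightarrow> of_int (sc r) = r * of_int D"
      and sc_le: "\<And>r. r \<in> set L \<Longrightarrow> \<bar>sc r\<bar> \<le> 2 ^ (2 * S)" by metis
    have sc_bound: "\<bar>sc r\<bar> \<le> 2 ^ (2 * \<phi>)" if "r \<in> set L" for r
      using sc_le[OF that] by (rule order_trans) (use S\<phi> in \<open>intro power_increasing, auto\<close>)
    have sc_real: "real_of_int (sc r) = real_of_rat r * real_of_int D" if "r \<in> set L" for r
      using arg_cong[OF sc[OF that], of "of_rat :: rat \<Rightarrow> real"] by (simp add: of_rat_mult)
    have mat_mem: "M $$ (i, j) \<in> set (concat (map list_of_vec (rows M)))"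
      if "i < dim_row M" "j < dim_col M" for M :: "rat mat" and i j
    proof -
      have "row M i \<in> set (rows M)" using that by (auto simp: rows_def)
      moreover have "M $$ (i, j) \<in> set (list_of_vec (row M i))"
        using that by (auto simp: list_of_vec_map)
      ultimately show ?thesis by auto
    qed
    have vec_mem: "v $ i \<in> set (list_of_vec v)" if "i < dim_vec v" for v :: "rat vec" and i
      using that by (auto simp: list_of_vec_map)
    have HL: "H $$ (i, j) \<in> set L" if "i < n" "j < n" for i j
      using mat_mem[of i H j] that H by (auto simp: L_def)
    have AL: "A $$ (i, j) \<in> set L" if "i < m" "j < n" for i j
      using mat_mem[of i A j] that A by (auto simp: L_def)
    have cL: "c $ j \<in> set L" if "j < n" for j using vec_mem[of j c] that c by (auto simp: L_def)
    have bL: "b $ i \<in> set L" if "i < m" for i using vec_mem[of i b] that b by (auto simp: L_def)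
    have dL: "d \<in> set L" by (simp add: L_def)
    define H' where "H' i j = sc (H $$ (i, j))" for i j
    define c' where "c' j = sc (c $ j)" for j
    define Cs where "Cs = (\<lambda>i. (\<lambda>j. sc (A $$ (i, j)), sc (b $ i))) ` {..<m}"
    have feasible: "y \<in> miqp_feasible n p H c d A b \<longleftrightarrow>
        (\<forall>j\<in>{..<p}. y $ j \<in> \<int>) \<and> quad {..<n} H' c' (\<lambda>j. y $ j) + real_of_int (sc d) \<le> 0 \<and>
        (\<lambda>j. y $ j) \<in> feas {..<n} Cs" if y: "y \<in> carrier_vec n" for y
    proof -
      have "quad {..<n} H' c' (\<lambda>j. y $ j) + real_of_int (sc d) =
          D * (y \<bullet> (map_mat of_rat H *\<^sub>v y) + map_vec of_rat c \<bullet> y + of_rat d)"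
        using y H c by (simp add: quad_def bil_def lin_def H'_def c'_def sc_real HL cL dL
            scalar_prod_def atLeast0LessThan sum_distrib_left distrib_left mult_ac)
      then have 1: "quad {..<n} H' c' (\<lambda>j. y $ j) + real_of_int (sc d) \<le> 0 \<longleftrightarrow>
          y \<bullet> (map_mat of_rat H *\<^sub>v y) + map_vec of_rat c \<bullet> y + of_rat d \<le> 0"
        using D by (simp add: mult_le_0_iff)
      have "lin {..<n} (\<lambda>j. sc (A $$ (i, j))) (\<lambda>j. y $ j) \<le> real_of_int (sc (b $ i)) \<longleftrightarrow>
          (map_mat of_rat A *\<^sub>v y) $ i \<le> map_vec of_rat b $ i" if i: "i < m" for i
      proof -
        have "lin {..<n} (\<lambda>j. sc (A $$ (i, j))) (\<lambda>j. y $ j) = D * ((map_mat of_rat A *\<^sub>v y) $ i)"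
          using y A i by (simp add: lin_def sc_real AL scalar_prod_def atLeast0LessThan sum_distrib_left mult_ac)
        moreover have "real_of_int (sc (b $ i)) = D * (map_vec of_rat b $ i)"
          using b i by (simp add: sc_real bL)
        ultimately show ?thesis using D by simp
      qed
      then have 2: "(\<lambda>j. y $ j) \<in> feas {..<n} Cs \<longleftrightarrow> map_mat of_rat A *\<^sub>v y \<le> map_vec of_rat b"
        using A b by (auto simp: feas_def Cs_def less_eq_vec_def)
      show ?thesis using y 1 2 by (auto simp: miqp_feasible_def)
    qed
    have xc: "x \<in> carrier_vec n" using x by (simp add: miqp_feasible_def)
    define e where "e = miqp_exp \<phi> (2 * \<phi>)"
    have "small_feasible {..<n} {..<p} Cs H' c' (sc d) e"
      unfolding e_def
    proof (rule miqp_small_feasible[where x = "\<lambda>j. x $ j"])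
      show "card Cs \<le> \<phi>" using card_image_le[of "{..<m}"] m\<phi> unfolding Cs_def by (metis card_lessThan finite_lessThan order_trans)
      show "\<bar>fst c v\<bar> \<le> 2 ^ (2 * \<phi>)" if "c \<in> Cs" "v \<in> {..<n}" for c v
        using that sc_bound AL by (auto simp: Cs_def)
      show "\<bar>snd c\<bar> \<le> 2 ^ (2 * \<phi>)" if "c \<in> Cs" for c
        using that sc_bound bL by (auto simp: Cs_def)
    qed (use p n\<phi> x feasible[OF xc] sc_bound HL cL dL in \<open>auto simp: H'_def c'_def Cs_def\<close>)
    then obtain t :: int and k :: "nat \<Rightarrow> int" where t: "1 \<le> t" "t \<le> 2 ^ e" and k: "\<forall>v\<in>{..<n}. \<bar>k v\<bar> \<le> 2 ^ e"
      and sol: "(\<lambda>v. k v / t) \<in> feas {..<n} Cs" "\<forall>v\<in>{..<p}. k v / t \<in> \<int>"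
        "quad {..<n} H' c' (\<lambda>v. k v / t) + sc d \<le> 0"
      unfolding small_feasible_def by blast
    define x0 :: "rat vec" where "x0 = Matrix.vec n (\<lambda>j. of_int (k j) / of_int t)"
    have x0: "map_vec real_of_rat x0 $ j = k j / t" if "j < n" for j
      using that by (simp add: x0_def of_rat_divide)
    have "map_vec of_rat x0 \<in> miqp_feasible n p H c d A b"
    proof (subst feasible)
      show "map_vec real_of_rat x0 \<in> carrier_vec n" by (simp add: x0_def)
      show "(\<forall>j\<in>{..<p}. map_vec real_of_rat x0 $ j \<in> \<int>) \<and>
        quad {..<n} H' c' (\<lambda>j. map_vec real_of_rat x0 $ j) + real_of_int (sc d) \<le> 0 \<and>
        (\<lambda>j. map_vec real_of_rat x0 $ j) \<in> feas {..<n} Cs"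
        using sol p x0 quad_cong[of "{..<n}" "\<lambda>j. map_vec real_of_rat x0 $ j" "\<lambda>v. k v / t" H' c']
          feas_cong[of "{..<n}" "\<lambda>j. map_vec real_of_rat x0 $ j" "\<lambda>v. k v / t" Cs] by auto
    qed
    moreover have "vec_complexity x0 \<le> \<phi> * (2 * e + 4)"
    proof -
      have "(\<Sum>i<n. rat_complexity (x0 $ i)) \<le> (\<Sum>i<n. 2 * e + 3)"
        using t k by (intro sum_mono) (auto simp: x0_def intro!: rat_complexity_quotient_le)
      then have "vec_complexity x0 \<le> n * (2 * e + 4)"
        unfolding vec_complexity_eq by (simp add: x0_def algebra_simps)
      also have "\<dots> \<le> \<phi> * (2 * e + 4)" using n\<phi> by (rule mult_le_mono1)
      finally show ?thesis .
    qed
    then have "real (vec_complexity x0) \<le> poly f (real \<phi>)"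
      unfolding f[symmetric] e_def by (simp only: of_nat_le_iff)
    ultimately show "\<exists>x0 :: rat vec. map_vec of_rat x0 \<in> miqp_feasible n p H c d A b \<and>
         real (vec_complexity x0) \<le> poly f (real (miqp_complexity H c d A b))"
      unfolding \<phi>_def by blast
  qed
qed

end
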